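(* Let $G$ be a finite solvable group and let $H$ be a normal subgroup of $G$. Then $\bigcap_{p\in\pi(H)}N_{\mathscr{U}_p}(G,H)=1$ if and only if $N_{\mathscr{U}}(G,H)=1$.
   Context: All groups are finite. $\pi(H)$ is the set of prime divisors of $|H|$ (an empty intersection of subgroups of $G$ is $G$). $\mathscr{U}$ is the class of supersolvable groups; $\mathscr{U}_p$ is the class of $p$-supersolvable groups, i.e. groups each of whose chief factors is either of order $p$ or a $p'$-group. For $\mathscr{F}\in\{\mathscr{U},\mathscr{U}_p\}$ and a group $T$, $T^{\mathscr{F}}$ (the $\mathscr{F}$-residual) is the intersection of all normal subgroups $N$ of $T$ with $T/N\in\mathscr{F}$. For $H\le G$, $N_{\mathscr{F}}(G,H)=\bigcap_{T\le H}N_G(T^{\mathscr{F}})$, the intersection being over all subgroups $T$ of $H$. *)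

theory Defs
  imports "HOL-Algebra.Algebra"
begin

(* The subgroups N reachable from the trivial one by a series of subgroups that are all
   normal in the whole group G (not only in the next term) with cyclic factors; compare
   solvable_seq in HOL-Algebra.Solvable_Groups. *)
inductive supersolvable_seq :: "('a, 'b) monoid_scheme \<Rightarrow> 'a set \<Rightarrow> bool"
  for G where
    unity: "supersolvable_seq G {\<one>\<^bsub>G\<^esub>}"
  | extension: "\<lbrakk> supersolvable_seq G K; K \<lhd> G; N \<lhd> G; K \<subseteq> N;
                  cyclic_group ((G \<lparr> carrier := N \<rparr>) Mod K) \<rbrakk> \<Longrightarrow> supersolvable_seq G N"

definition supersolvable :: "('a, 'b) monoid_scheme \<Rightarrow> bool"
  where "supersolvable G \<longleftrightarrow> group G \<and> finite (carrier G) \<and> supersolvable_seq G (carrier G)"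

(* chief_factor G K L: the factor is K / L. *)
definition chief_factor :: "('a, 'b) monoid_scheme \<Rightarrow> 'a set \<Rightarrow> 'a set \<Rightarrow> bool"
  where "chief_factor G K L \<longleftrightarrow>
    K \<lhd> G \<and> L \<lhd> G \<and> L \<subset> K \<and>
    (\<forall>M. M \<lhd> G \<and> L \<subseteq> M \<and> M \<subseteq> K \<longrightarrow> M = L \<or> M = K)"

definition p_supersolvable :: "nat \<Rightarrow> ('a, 'b) monoid_scheme \<Rightarrow> bool"
  where "p_supersolvable p G \<longleftrightarrow> group G \<and> finite (carrier G) \<and>
    (\<forall>K L. chief_factor G K L \<longrightarrow>
       Coset.order ((G \<lparr> carrier := K \<rparr>) Mod L) = p \<or> \<not> p dvd Coset.order ((G \<lparr> carrier := K \<rparr>) Mod L))"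

(* A class of groups F enters only through quotients T / N, whose elements are cosets;
   hence its type. *)
definition residual :: "('a set monoid \<Rightarrow> bool) \<Rightarrow> ('a, 'b) monoid_scheme \<Rightarrow> 'a set"
  where "residual F T = carrier T \<inter> \<Inter> {N. N \<lhd> T \<and> F (T Mod N)}"

definition residual_normalizer ::
  "('a set monoid \<Rightarrow> bool) \<Rightarrow> ('a, 'b) monoid_scheme \<Rightarrow> 'a set \<Rightarrow> 'a set"
  where "residual_normalizer F G H =
    (\<Inter>T \<in> {T. subgroup T (G \<lparr> carrier := H \<rparr>)}. normalizer G (residual F (G \<lparr> carrier := T \<rparr>)))"

end

theory Submission
  imports Defs
begin

text \<open>
  The two sides agree because the two subgroups are equal: an element of \<open>G\<close> normalizes
  the \<open>\<UU>\<close>-residual \<open>R\<close> of every subgroup \<open>T\<close> of \<open>H\<close> if and only if it normalizes the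
  \<open>\<UU>\<^sub>p\<close>-residual \<open>R\<^sub>p\<close> of every such \<open>T\<close>, for all primes \<open>p\<close> dividing the order of \<open>H\<close>. For a fixed
  \<open>T\<close> each side can be recovered from the other by a recipe that commutes with conjugation.

  \<^item> \<open>R\<close> is generated by the \<open>R\<^sub>p\<close> (\<open>residual_eq_generate_p_residuals\<close>). The chief factors of the
    solvable group \<open>T\<close> have prime power order, so such an order is a prime as soon as it is, for
    every \<open>p\<close> dividing the order of \<open>T\<close>, either \<open>p\<close> or prime to \<open>p\<close>.
  \<^item> \<open>R\<^sub>p\<close> is generated by the elements of \<open>p\<close>-power order of \<open>R\<close> (\<open>p_residual_eq_generate\<close>), that is,
    \<open>R\<^sub>p\<close> is the \<open>p'\<close>-residual of \<open>R\<close>. The point is that \<open>R\<^sub>p\<close> has index prime to \<open>p\<close> in \<open>R\<close>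
    (\<open>index_residual_coprime\<close>), and this holds because a solvable \<open>p\<close>-supersolvable group \<open>X\<close>
    without nontrivial normal \<open>p'\<close>-subgroups is supersolvable
    (\<open>p_supersolvable_core_free_imp_prime_indices\<close>): the derived subgroup of \<open>X\<close> is then a
    \<open>p\<close>-group, so the chief factors of \<open>X\<close> below it have order \<open>p\<close>, and those of the abelian quotient
    have prime order.

  Both classes are handled in one way, through the orders of chief factors. A quotient \<open>T/N\<close>
  belongs to the class if and only if the order of every chief factor of \<open>T\<close> above \<open>N\<close> lies in a
  fixed set \<open>S\<close> of numbers: \<open>S\<close> consists of the primes for \<open>\<UU>\<close>, and of \<open>p\<close> and the numbers not divisible
  by \<open>p\<close> for \<open>\<UU>\<^sub>p\<close>. Projecting chief factors along normal subgroups
  (\<open>chief_factor_projection\<close>) shows that the normal subgroups \<open>N\<close> with this property are closed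
  under intersection, so that the residual is the least of them.
\<close>

(* The unqualified name is to mean primality of numbers, not of elements of a monoid. *)
hide_const (open) Divisibility.prime

section \<open>Quotients and normal subgroups\<close>

lemma (in group) quotient_hom:
  assumes "N \<lhd> G" shows "group_hom G (G Mod N) ((#>) N)"
  using normal.r_coset_hom_Mod[OF assms] normal.factorgroup_is_group[OF assms]
  by (simp add: group_hom_def group_hom_axioms_def is_group)

lemma (in group) quotient_surj: "(#>) N ` carrier G = carrier (G Mod N)"
  by (simp add: carrier_FactGroup)

lemma (in group) quotient_eq_one_iff:
  assumes "N \<lhd> G" "x \<in> carrier G" shows "N #> x = N \<longleftrightarrow> x \<in> N"
proof -
  have N: "subgroup N G" using assms(1) by (rule normal_imp_subgroup)
  show ?thesis
    using coset_join1[OF _ assms(2) N] coset_join2[OF assms(2) N] by blast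
qed

lemma (in group) mem_coset_image_iff:
  assumes "N \<lhd> G" "subgroup K G" "N \<subseteq> K" "x \<in> carrier G"
  shows "N #> x \<in> (#>) N ` K \<longleftrightarrow> x \<in> K"
proof
  assume "N #> x \<in> (#>) N ` K"
  then obtain k where k: "k \<in> K" "N #> x = N #> k" by auto
  have "x \<in> N #> k"
    using k(2) rcos_self[OF assms(4) normal_imp_subgroup[OF assms(1)]] by simp
  then show "x \<in> K"
    using assms(2,3) k(1) by (auto simp: r_coset_def subgroup.m_closed)
qed auto

lemma (in group) coset_image_subset_iff:
  assumes "N \<lhd> G" "subgroup K G" "N \<subseteq> K" "L \<subseteq> carrier G"
  shows "(#>) N ` L \<subseteq> (#>) N ` K \<longleftrightarrow> L \<subseteq> K"
proof
  assume a: "(#>) N ` L \<subseteq> (#>) N ` K"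
  show "L \<subseteq> K"
  proof
    fix x assume x: "x \<in> L"
    then have "N #> x \<in> (#>) N ` K" using a by blast
    then show "x \<in> K" using mem_coset_image_iff[OF assms(1-3)] assms(4) x by blast
  qed
qed blast

lemma (in group) coset_image_eq_iff:
  assumes "N \<lhd> G" "subgroup K G" "N \<subseteq> K" "subgroup L G" "N \<subseteq> L"
  shows "(#>) N ` L = (#>) N ` K \<longleftrightarrow> L = K"
  using coset_image_subset_iff[OF assms(1,2,3) subgroup.subset[OF assms(4)]]
    coset_image_subset_iff[OF assms(1,4,5) subgroup.subset[OF assms(2)]]
  by (simp only: set_eq_subset)

lemma (in group) coset_image_subgroup:
  assumes "N \<lhd> G" "subgroup K G" shows "subgroup ((#>) N ` K) (G Mod N)"
  by (rule group_hom.subgroup_img_is_subgroup[OF quotient_hom[OF assms(1)] assms(2)])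

lemma (in group) coset_image_normal:
  assumes "N \<lhd> G" "K \<lhd> G" shows "(#>) N ` K \<lhd> G Mod N"
  by (rule normal.surj_hom_normal_subgroup[OF assms(2) quotient_hom[OF assms(1)] quotient_surj])

text \<open>Union is the inverse of \<open>(#>) N ` K\<close>: it turns a subgroup of the quotient, which is a set of
  cosets, into the subgroup of \<open>G\<close> that it comes from. These two maps are the correspondence
  between subgroups of \<open>G Mod N\<close> and subgroups of \<open>G\<close> above \<open>N\<close>.\<close>
lemma (in group) Union_of_cosets:
  assumes "N \<lhd> G" "subgroup V (G Mod N)"
  shows "N \<subseteq> \<Union>V" "(#>) N ` \<Union>V = V"
proof -
  have one: "N \<in> V" using subgroup.one_closed[OF assms(2)] by simp
  then show "N \<subseteq> \<Union>V" by blast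
  have "V \<subseteq> (#>) N ` carrier G"
    using subgroup.subset[OF assms(2)] by (simp add: carrier_FactGroup)
  then show "(#>) N ` \<Union>V = V"
    unfolding normal.factgroup_subgroup_union_char[OF assms] by auto
qed

lemma (in group) normal_of_coset_image_normal:
  assumes "N \<lhd> G" "subgroup K G" "N \<subseteq> K" "(#>) N ` K \<lhd> G Mod N"
  shows "K \<lhd> G"
proof -
  have n: "\<Union>((#>) N ` K) \<lhd> G"
    by (rule normal.factgroup_subgroup_union_normal[OF assms(1,4)])
  have "subgroup ((#>) N ` K) (G Mod N)" using assms(4) by (rule normal_imp_subgroup)
  then have "\<Union>((#>) N ` K) = {x \<in> carrier G. N #> x \<in> (#>) N ` K}"
    by (rule normal.factgroup_subgroup_union_char[OF assms(1)])
  also have "\<dots> = K"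
    using mem_coset_image_iff[OF assms(1-3)] subgroup.subset[OF assms(2)] by blast
  finally show ?thesis using n by simp
qed

lemma (in group) FactGroup_restrict:
  "(G\<lparr>carrier := K\<rparr>) Mod N = (G Mod N)\<lparr>carrier := (#>) N ` K\<rparr>"
proof -
  have "(<#>\<^bsub>G\<lparr>carrier := K\<rparr>\<^esub>) = (<#>)" by (intro ext) simp
  then show ?thesis by (auto simp: FactGroup_def RCOSETS_def)
qed

lemma (in group) subgroup_card_dvd:
  assumes "subgroup H G" "subgroup K G" "H \<subseteq> K"
  shows "card H dvd card K"
proof -
  interpret K: group "G\<lparr>carrier := K\<rparr>" using assms(2) by (rule subgroup_imp_group)
  have "subgroup H (G\<lparr>carrier := K\<rparr>)" using assms by (simp add: subgroup_incl)
  from K.lagrange[OF this]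
  have "card (rcosets\<^bsub>G\<lparr>carrier := K\<rparr>\<^esub> H) * card H = card K" by (simp add: order_def)
  then show ?thesis by (metis dvd_triv_right)
qed

lemma (in group) card_coset_image:
  assumes "subgroup N G" "subgroup K G" "N \<subseteq> K"
  shows "card ((#>) N ` K) * card N = card K"
proof -
  interpret K: group "G\<lparr>carrier := K\<rparr>" using assms(2) by (rule subgroup_imp_group)
  have "subgroup N (G\<lparr>carrier := K\<rparr>)" using assms by (simp add: subgroup_incl)
  from K.lagrange[OF this]
  have "card (rcosets\<^bsub>G\<lparr>carrier := K\<rparr>\<^esub> N) * card N = card K" by (simp add: order_def)
  moreover have "rcosets\<^bsub>G\<lparr>carrier := K\<rparr>\<^esub> N = (#>) N ` K" by (auto simp: RCOSETS_def)
  ultimately show ?thesis by simp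
qed

lemma (in group) subgroup_card_pos:
  assumes "finite (carrier G)" "subgroup K G" shows "0 < card K"
  using subgroup.finite_imp_card_positive[OF assms(2,1)] .

lemma (in group) index_coset_image:
  assumes "finite (carrier G)" "N \<lhd> G" "subgroup K G" "subgroup L G" "N \<subseteq> L" "L \<subseteq> K"
  shows "card ((#>) N ` K) div card ((#>) N ` L) = card K div card L"
proof -
  have N: "subgroup N G" using assms(2) by (rule normal_imp_subgroup)
  have 1: "card ((#>) N ` K) * card N = card K" "card ((#>) N ` L) * card N = card L"
    using card_coset_image[OF N] assms by auto
  have "0 < card N" using subgroup_card_pos[OF assms(1) N] .
  then show ?thesis unfolding 1[symmetric] by simp
qed

section \<open>Chief factors\<close>

text \<open>Indices are quotients of cardinalities, which avoids forming the quotient groups; the division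
  is exact by Lagrange's theorem.\<close>
definition chief_indices_in :: "('a, 'b) monoid_scheme \<Rightarrow> 'a set \<Rightarrow> nat set \<Rightarrow> bool"
  where "chief_indices_in G N S \<longleftrightarrow>
    (\<forall>K L. chief_factor G K L \<and> N \<subseteq> L \<longrightarrow> card K div card L \<in> S)"

lemma (in group) order_chief_quotient:
  assumes "finite (carrier G)" "subgroup K G" "subgroup L G" "L \<subseteq> K"
  shows "Coset.order ((G\<lparr>carrier := K\<rparr>) Mod L) = card K div card L"
proof -
  have "Coset.order ((G\<lparr>carrier := K\<rparr>) Mod L) = card ((#>) L ` K)"
    by (simp add: FactGroup_restrict order_def)
  also have "\<dots> = card K div card L"
    unfolding card_coset_image[OF assms(3,2,4), symmetric]
    using subgroup_card_pos[OF assms(1,3)] by simp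
  finally show ?thesis .
qed

lemma chief_factorD:
  assumes "chief_factor G K L"
  shows "K \<lhd> G" "L \<lhd> G" "L \<subset> K" "subgroup K G" "subgroup L G"
    "\<And>M. M \<lhd> G \<Longrightarrow> L \<subseteq> M \<Longrightarrow> M \<subseteq> K \<Longrightarrow> M = L \<or> M = K"
  using assms unfolding chief_factor_def by (auto dest: normal_imp_subgroup)

lemma (in group) chief_factor_coset_image_iff:
  assumes N: "N \<lhd> G" and K: "K \<lhd> G" and L: "L \<lhd> G" and "N \<subseteq> L" "L \<subseteq> K"
  shows "chief_factor (G Mod N) ((#>) N ` K) ((#>) N ` L) \<longleftrightarrow> chief_factor G K L"
proof
  note sub = normal_imp_subgroup[OF K] normal_imp_subgroup[OF L]
  have NK: "N \<subseteq> K" using assms by blast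
  show "chief_factor (G Mod N) ((#>) N ` K) ((#>) N ` L)" if c: "chief_factor G K L"
    unfolding chief_factor_def
  proof (intro conjI allI impI)
    show "(#>) N ` K \<lhd> G Mod N" "(#>) N ` L \<lhd> G Mod N"
      using coset_image_normal N K L by auto
    show "(#>) N ` L \<subset> (#>) N ` K"
      using coset_image_subset_iff[OF N sub(2) assms(4) subgroup.subset[OF sub(1)]]
        chief_factorD(3)[OF c] by blast
    fix V assume V: "V \<lhd> G Mod N \<and> (#>) N ` L \<subseteq> V \<and> V \<subseteq> (#>) N ` K"
    let ?M = "\<Union>V"
    have sV: "subgroup V (G Mod N)" using V by (auto dest: normal_imp_subgroup)
    have M: "?M \<lhd> G" using normal.factgroup_subgroup_union_normal[OF N] V by blast
    note sM = normal_imp_subgroup[OF M]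
    have im: "(#>) N ` ?M = V" "N \<subseteq> ?M" using Union_of_cosets[OF N sV] by auto
    have "L \<subseteq> ?M"
      using coset_image_subset_iff[OF N sM im(2) subgroup.subset[OF sub(2)]] V im(1) by simp
    moreover have "?M \<subseteq> K"
      using coset_image_subset_iff[OF N sub(1) NK subgroup.subset[OF sM]] V im(1) by simp
    ultimately have "?M = L \<or> ?M = K" using chief_factorD(6)[OF c M] by blast
    then show "V = (#>) N ` L \<or> V = (#>) N ` K" using im(1) by auto
  qed
  show "chief_factor G K L" if c: "chief_factor (G Mod N) ((#>) N ` K) ((#>) N ` L)"
    unfolding chief_factor_def
  proof (intro conjI allI impI)
    show "L \<subset> K" using chief_factorD(3)[OF c] assms(5) by blast
    fix M assume M: "M \<lhd> G \<and> L \<subseteq> M \<and> M \<subseteq> K"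
    have sM: "subgroup M G" using M by (auto dest: normal_imp_subgroup)
    have NM: "N \<subseteq> M" using M assms by blast
    have "(#>) N ` M = (#>) N ` L \<or> (#>) N ` M = (#>) N ` K"
      using chief_factorD(6)[OF c coset_image_normal[OF N]] M by blast
    then show "M = L \<or> M = K"
      using coset_image_eq_iff[OF N sub(2) assms(4) sM NM] coset_image_eq_iff[OF N sub(1) NK sM NM]
      by blast
  qed (rule K, rule L)
qed

text \<open>This moves statements about the group \<open>G Mod N\<close>, whose elements are sets, to statements about
  \<open>G\<close> itself and back.\<close>
lemma (in group) chief_indices_in_quotient_iff:
  assumes fin: "finite (carrier G)" and N: "N \<lhd> G"
  shows "chief_indices_in (G Mod N) {\<one>\<^bsub>G Mod N\<^esub>} S \<longleftrightarrow> chief_indices_in G N S"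
proof
  show "chief_indices_in G N S" if a: "chief_indices_in (G Mod N) {\<one>\<^bsub>G Mod N\<^esub>} S"
    unfolding chief_indices_in_def
  proof (intro allI impI, elim conjE)
    fix K L assume c: "chief_factor G K L" and NL: "N \<subseteq> L"
    note cD = chief_factorD[OF c]
    have c': "chief_factor (G Mod N) ((#>) N ` K) ((#>) N ` L)"
      using chief_factor_coset_image_iff[OF N cD(1,2) NL] cD(3) c by blast
    have "{\<one>\<^bsub>G Mod N\<^esub>} \<subseteq> (#>) N ` L"
      using subgroup.one_closed[OF chief_factorD(5)[OF c']] by simp
    then have "card ((#>) N ` K) div card ((#>) N ` L) \<in> S"
      using a c' unfolding chief_indices_in_def by blast
    then show "card K div card L \<in> S"
      using index_coset_image[OF fin N cD(4,5) NL] cD(3) by auto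
  qed
  show "chief_indices_in (G Mod N) {\<one>\<^bsub>G Mod N\<^esub>} S" if a: "chief_indices_in G N S"
    unfolding chief_indices_in_def
  proof (intro allI impI, elim conjE)
    fix V W assume c: "chief_factor (G Mod N) V W"
    note cD = chief_factorD[OF c]
    have n: "\<Union>V \<lhd> G" "\<Union>W \<lhd> G"
      using normal.factgroup_subgroup_union_normal[OF N] cD(1,2) by auto
    note im = Union_of_cosets[OF N cD(4)] Union_of_cosets[OF N cD(5)]
    have le: "\<Union>W \<subseteq> \<Union>V" using cD(3) by blast
    have "chief_factor G (\<Union>V) (\<Union>W)"
      using chief_factor_coset_image_iff[OF N n im(3) le] c unfolding im(2,4) by (rule iffD1)
    then have "card (\<Union>V) div card (\<Union>W) \<in> S"
      using a im(3) unfolding chief_indices_in_def by blast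
    then show "card V div card W \<in> S"
      using index_coset_image[OF fin N n[THEN normal_imp_subgroup] im(3) le]
      unfolding im(2,4) by (simp only:)
  qed
qed

lemma (in group) normal_finite:
  assumes "finite (carrier G)" "K \<lhd> G" shows "finite K"
  using finite_subset[OF subgroup.subset[OF normal_imp_subgroup[OF assms(2)]] assms(1)] .

lemma (in group) chief_factor_above_exists:
  assumes fin: "finite (carrier G)" and "L \<lhd> G" "M \<lhd> G" "L \<subset> M"
  obtains K where "chief_factor G K L" "K \<subseteq> M"
proof -
  let ?P = "\<lambda>K. K \<lhd> G \<and> L \<subset> K \<and> K \<subseteq> M"
  have "?P M" using assms(3,4) by simp
  from ex_has_least_nat[of ?P, OF this, of card]
  obtain K where K: "?P K" and min: "\<And>K'. ?P K' \<Longrightarrow> card K \<le> card K'"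
    by iprover
  then have KD: "K \<lhd> G" "L \<subset> K" "K \<subseteq> M" by simp_all
  have "M' = L \<or> M' = K" if M': "M' \<lhd> G" "L \<subseteq> M'" "M' \<subseteq> K" for M'
  proof (cases "M' = L")
    case False
    then have "?P M'" using M' KD(3) by auto
    then show ?thesis using min card_seteq[OF normal_finite[OF fin KD(1)] M'(3)] by simp
  qed simp
  then have "chief_factor G K L" unfolding chief_factor_def using KD(1,2) assms(2) by simp
  then show ?thesis using that KD(3) by simp
qed

lemma (in group) chief_factor_below_exists:
  assumes fin: "finite (carrier G)" and "L \<lhd> G" "M \<lhd> G" "L \<subset> M"
  obtains K where "chief_factor G M K" "L \<subseteq> K"
proof -
  let ?P = "\<lambda>K. K \<lhd> G \<and> L \<subseteq> K \<and> K \<subset> M"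
  have P: "?P L" using assms(2,4) by simp
  have "\<forall>K. ?P K \<longrightarrow> card K < Suc (card M)"
    using card_mono[OF normal_finite[OF fin assms(3)]] by (simp add: psubset_eq less_Suc_eq_le)
  from ex_has_greatest_nat[of ?P, OF P this]
  obtain K where K: "?P K" and max: "\<And>K'. ?P K' \<Longrightarrow> card K' \<le> card K"
    by iprover
  then have KD: "K \<lhd> G" "L \<subseteq> K" "K \<subset> M" by simp_all
  have "M' = K \<or> M' = M" if M': "M' \<lhd> G" "K \<subseteq> M'" "M' \<subseteq> M" for M'
  proof (cases "M' = M")
    case False
    then have "?P M'" using M' KD(2) by auto
    then show ?thesis using max card_seteq[OF normal_finite[OF fin M'(1)] M'(2)] by simp
  qed simp
  then have "chief_factor G M K" unfolding chief_factor_def using KD(1,3) assms(3) by simp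
  then show ?thesis using that KD(2) by simp
qed

section \<open>Projections of chief factors\<close>

lemma (in group) mem_set_mult_iff: "x \<in> A <#> B \<longleftrightarrow> (\<exists>a\<in>A. \<exists>b\<in>B. x = a \<otimes> b)"
  by (auto simp: set_mult_def)

lemma (in group) card_set_mult:
  assumes N: "N \<lhd> G" and K: "subgroup K G"
  shows "card (N <#> K) * card (N \<inter> K) = card N * card K"
proof -
  interpret second_isomorphism_grp N G K
    using N K by (simp add: second_isomorphism_grp_def second_isomorphism_grp_axioms_def)
  note sN = normal_imp_subgroup[OF N]
  have sI: "subgroup (N \<inter> K) G" by (rule subgroups_Inter_pair[OF sN K])
  have "Coset.order ((G\<lparr>carrier := K\<rparr>) Mod (N \<inter> K)) = Coset.order ((G\<lparr>carrier := N <#> K\<rparr>) Mod N)"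
    by (rule iso_same_order[OF normal_intersection_quotient_isom])
  then have eq: "card ((#>) (N \<inter> K) ` K) = card ((#>) N ` (N <#> K))"
    by (simp add: FactGroup_restrict order_def)
  have 1: "card ((#>) (N \<inter> K) ` K) * card (N \<inter> K) = card K"
    by (rule card_coset_image[OF sI K]) simp
  have 2: "card ((#>) N ` (N <#> K)) * card N = card (N <#> K)"
    by (rule card_coset_image[OF sN normal_set_mult_subgroup H_contained_in_set_mult])
  show ?thesis unfolding 2[symmetric] 1[symmetric] eq by simp
qed

lemma (in group) set_mult_upper:
  assumes "subgroup A G" "subgroup B G"
  shows "A \<subseteq> A <#> B" "B \<subseteq> A <#> B"
proof -
  show "A \<subseteq> A <#> B"
  proof
    fix a assume "a \<in> A"
    moreover from this have "a = a \<otimes> \<one>" using subgroup.mem_carrier[OF assms(1)] by simp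
    ultimately show "a \<in> A <#> B"
      unfolding mem_set_mult_iff using subgroup.one_closed[OF assms(2)] by blast
  qed
  show "B \<subseteq> A <#> B"
  proof
    fix b assume "b \<in> B"
    moreover from this have "b = \<one> \<otimes> b" using subgroup.mem_carrier[OF assms(2)] by simp
    ultimately show "b \<in> A <#> B"
      unfolding mem_set_mult_iff using subgroup.one_closed[OF assms(1)] by blast
  qed
qed

lemma (in group) set_mult_least:
  assumes "subgroup M G" "A \<subseteq> M" "B \<subseteq> M" shows "A <#> B \<subseteq> M"
  using mono_set_mult[OF assms(2,3), of G] subgroup_mult_id[OF assms(1)]
  by simp

text \<open>This and the next lemma are the two halves of Dedekind's modular law: they say that
  \<open>M \<mapsto> B <#> M\<close> and \<open>M \<mapsto> A \<inter> M\<close> are inverse to each other between the intervals from \<open>A \<inter> B\<close> to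
  \<open>A\<close> and from \<open>B\<close> to \<open>B <#> A\<close>.\<close>
lemma (in group) set_mult_Int_lower:
  assumes "subgroup A G" "subgroup B G" "subgroup M G" "A \<inter> B \<subseteq> M" "M \<subseteq> A"
  shows "A \<inter> (B <#> M) \<subseteq> M"
proof
  fix x assume x: "x \<in> A \<inter> (B <#> M)"
  then obtain b m where bm: "b \<in> B" "m \<in> M" "x = b \<otimes> m" by (auto simp: mem_set_mult_iff)
  have c: "b \<in> carrier G" "m \<in> carrier G"
    using bm(1,2) subgroup.mem_carrier[OF assms(2)] subgroup.mem_carrier[OF assms(3)] by simp_all
  have "b = x \<otimes> inv m" using bm c by (simp add: m_assoc)
  moreover have "m \<in> A" using bm assms(5) by blast
  then have "x \<otimes> inv m \<in> A"
    using x subgroup.m_closed[OF assms(1)] subgroup.m_inv_closed[OF assms(1)] by blast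
  ultimately have "b \<in> M" using bm(1) assms(4) by blast
  then show "x \<in> M" using bm subgroup.m_closed[OF assms(3)] by blast
qed

lemma (in group) set_mult_Int_upper:
  assumes "subgroup A G" "subgroup B G" "subgroup M G" "B \<subseteq> M" "M \<subseteq> B <#> A"
  shows "M \<subseteq> B <#> (A \<inter> M)"
proof
  fix x assume x: "x \<in> M"
  then obtain b a where ab: "b \<in> B" "a \<in> A" "x = b \<otimes> a"
    using assms(5) mem_set_mult_iff[of x B A] by blast
  have c: "b \<in> carrier G" "a \<in> carrier G"
    using ab(1,2) subgroup.mem_carrier[OF assms(2)] subgroup.mem_carrier[OF assms(1)] by simp_all
  have "a = inv b \<otimes> x" using ab c by (simp add: m_assoc[symmetric])
  moreover have "inv b \<in> M" using ab assms(4) subgroup.m_inv_closed[OF assms(3)] by blast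
  ultimately have "a \<in> M" using x subgroup.m_closed[OF assms(3)] by blast
  then show "x \<in> B <#> (A \<inter> M)" unfolding mem_set_mult_iff using ab by blast
qed

text \<open>The two intervals are isomorphic by the modular law, and normality of subgroups is preserved by
  the isomorphism in both directions.\<close>
lemma (in group) chief_factor_transpose:
  assumes A: "A \<lhd> G" and B: "B \<lhd> G"
  shows "chief_factor G (B <#> A) B \<longleftrightarrow> chief_factor G A (A \<inter> B)"
proof
  note sA = normal_imp_subgroup[OF A] and sB = normal_imp_subgroup[OF B]
  note BA = normal_subgroup_set_mult_closed[OF B A]
  note up = set_mult_upper[OF sB sA]
  show "chief_factor G (B <#> A) B" if c: "chief_factor G A (A \<inter> B)"
    unfolding chief_factor_def
  proof (intro conjI allI impI BA B)
    show "B \<subset> B <#> A" using chief_factorD(3)[OF c] up by blast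
    fix M assume M: "M \<lhd> G \<and> B \<subseteq> M \<and> M \<subseteq> B <#> A"
    then have MD: "M \<lhd> G" "B \<subseteq> M" "M \<subseteq> B <#> A" by simp_all
    note sM = normal_imp_subgroup[OF MD(1)]
    have "A \<inter> M = A \<inter> B \<or> A \<inter> M = A"
      by (rule chief_factorD(6)[OF c normal_subgroup_intersect[OF A MD(1)]]) (use MD in auto)
    then show "M = B \<or> M = B <#> A"
    proof
      assume "A \<inter> M = A \<inter> B"
      then have "M \<subseteq> B <#> (A \<inter> B)" using set_mult_Int_upper[OF sA sB sM MD(2,3)] by simp
      also have "\<dots> \<subseteq> B" by (rule set_mult_least[OF sB]) auto
      finally show ?thesis using MD(2) by simp
    next
      assume "A \<inter> M = A"
      then have "A \<subseteq> M" by blast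
      then have "B <#> A \<subseteq> M" using set_mult_least[OF sM MD(2)] by simp
      then show ?thesis using MD(3) by simp
    qed
  qed
  show "chief_factor G A (A \<inter> B)" if c: "chief_factor G (B <#> A) B"
    unfolding chief_factor_def
  proof (intro conjI allI impI A normal_subgroup_intersect B)
    have "\<not> A \<subseteq> B"
    proof
      assume "A \<subseteq> B"
      then have "B <#> A \<subseteq> B" using set_mult_least[OF sB] by simp
      then show False using chief_factorD(3)[OF c] by blast
    qed
    then show "A \<inter> B \<subset> A" by blast
    fix M assume M: "M \<lhd> G \<and> A \<inter> B \<subseteq> M \<and> M \<subseteq> A"
    then have MD: "M \<lhd> G" "A \<inter> B \<subseteq> M" "M \<subseteq> A" by simp_all
    note sM = normal_imp_subgroup[OF MD(1)]
    note lo = set_mult_Int_lower[OF sA sB sM MD(2,3)]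
    note up' = set_mult_upper[OF sB sM]
    have "B <#> M = B \<or> B <#> M = B <#> A"
      by (rule chief_factorD(6)[OF c normal_subgroup_set_mult_closed[OF B MD(1)] up'(1)])
        (rule mono_set_mult[OF subset_refl MD(3)])
    then show "M = A \<inter> B \<or> M = A"
    proof
      assume "B <#> M = B"
      then have "M \<subseteq> A \<inter> B" using up'(2) MD(3) by simp
      then have "M = A \<inter> B" using MD(2) by (rule subset_antisym)
      then show ?thesis ..
    next
      assume "B <#> M = B <#> A"
      then have "A \<subseteq> M" using up(2) lo by blast
      then show ?thesis using MD(3) by simp
    qed
  qed
qed

lemma (in group) index_transpose:
  assumes fin: "finite (carrier G)" and A: "A \<lhd> G" and B: "B \<lhd> G"
  shows "card (B <#> A) div card B = card A div card (A \<inter> B)"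
proof -
  note sA = normal_imp_subgroup[OF A] and sB = normal_imp_subgroup[OF B]
  have sI: "subgroup (A \<inter> B) G" by (rule subgroups_Inter_pair[OF sA sB])
  have "card (A \<inter> B) dvd card A" by (rule subgroup_card_dvd[OF sI sA]) simp
  then obtain m where m: "card A = card (A \<inter> B) * m" ..
  have p: "0 < card (A \<inter> B)" "0 < card B"
    using subgroup_card_pos[OF fin] sI sB by auto
  have "card (B <#> A) * card (A \<inter> B) = card B * m * card (A \<inter> B)"
    using card_set_mult[OF B sA] unfolding Int_commute[of B A] by (auto simp: m)
  then have "card (B <#> A) = card B * m"
    using mult_right_cancel[of "card (A \<inter> B)"] p(1) by blast
  then show ?thesis using m nonzero_mult_div_cancel_left p by (metis less_numeral_extra(3))
qed

text \<open>A chief factor lives either above \<open>N\<close> or below \<open>N\<close>. As \<open>K \<inter> (N <#> L)\<close> lies between \<open>L\<close> and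
  \<open>K\<close>, it is one of them. If it is \<open>L\<close>, then multiplication by \<open>N\<close> does not collapse the factor; if
  it is \<open>K\<close>, then \<open>K = L <#> (N \<inter> K)\<close>, and intersection with \<open>N\<close> does not. Either way the
  factor is moved by transposition, so its order is kept. This takes the place of the
  Jordan-Hoelder theorem.\<close>
lemma (in group) chief_factor_projection:
  assumes fin: "finite (carrier G)" and c: "chief_factor G K L" and N: "N \<lhd> G"
  obtains "chief_factor G (N <#> K) (N <#> L)"
      "card (N <#> K) div card (N <#> L) = card K div card L"
  | "chief_factor G (N \<inter> K) (N \<inter> L)"
      "card (N \<inter> K) div card (N \<inter> L) = card K div card L"
proof -
  note cD = chief_factorD[OF c]
  note sN = normal_imp_subgroup[OF N]
  have LK: "L \<subseteq> K" using cD(3) by blast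
  have NL: "N <#> L \<lhd> G" by (rule normal_subgroup_set_mult_closed[OF N cD(2)])
  have "K \<inter> (N <#> L) = L \<or> K \<inter> (N <#> L) = K"
    by (rule cD(6)[OF normal_subgroup_intersect[OF cD(1) NL]])
      (use LK set_mult_upper[OF sN cD(5)] in auto)
  then show ?thesis
  proof
    assume a: "K \<inter> (N <#> L) = L"
    have "L <#> K = K"
      using set_mult_least[OF cD(4) LK] set_mult_upper[OF cD(5,4)] by blast
    then have NLK: "(N <#> L) <#> K = N <#> K"
      using set_mult_assoc[of N L K] subgroup.subset[OF sN] subgroup.subset[OF cD(4)]
        subgroup.subset[OF cD(5)] by simp
    show ?thesis
    proof (rule that(1))
      show "chief_factor G (N <#> K) (N <#> L)"
        using chief_factor_transpose[OF cD(1) NL] c unfolding a NLK by simp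
      show "card (N <#> K) div card (N <#> L) = card K div card L"
        using index_transpose[OF fin cD(1) NL] unfolding a NLK .
    qed
  next
    assume "K \<inter> (N <#> L) = K"
    then have sub: "K \<subseteq> N <#> L" by blast
    then have "K \<subseteq> L <#> N" using commut_normal[OF cD(5) N] by simp
    then have "K \<subseteq> L <#> (N \<inter> K)" by (rule set_mult_Int_upper[OF sN cD(5,4) LK])
    moreover have "L <#> (N \<inter> K) \<subseteq> K" by (rule set_mult_least[OF cD(4) LK]) simp
    ultimately have eq: "L <#> (N \<inter> K) = K" by simp
    have i: "(N \<inter> K) \<inter> L = N \<inter> L" using LK by blast
    have NK: "N \<inter> K \<lhd> G" by (rule normal_subgroup_intersect[OF N cD(1)])
    show ?thesis
    proof (rule that(2))
      show "chief_factor G (N \<inter> K) (N \<inter> L)"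
        using chief_factor_transpose[OF NK cD(2)] c unfolding i eq by simp
      show "card (N \<inter> K) div card (N \<inter> L) = card K div card L"
        using index_transpose[OF fin NK cD(2)] unfolding i eq by simp
    qed
  qed
qed

lemma chief_indices_inD:
  "chief_indices_in G N S \<Longrightarrow> chief_factor G K L \<Longrightarrow> N \<subseteq> L \<Longrightarrow> card K div card L \<in> S"
  by (simp add: chief_indices_in_def)

lemma (in group) chief_indices_in_extend:
  assumes fin: "finite (carrier G)" and N: "N \<lhd> G" and N_above: "chief_indices_in G N S"
    and N_below: "\<And>K L. chief_factor G K L \<Longrightarrow> K \<subseteq> N \<Longrightarrow> M \<inter> N \<subseteq> L \<Longrightarrow> card K div card L \<in> S"
  shows "chief_indices_in G M S"
  unfolding chief_indices_in_def
proof (intro allI impI, elim conjE)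
  fix K L assume c: "chief_factor G K L" and sub: "M \<subseteq> L"
  show "card K div card L \<in> S"
  proof (rule chief_factor_projection[OF fin c N])
    assume above: "chief_factor G (N <#> K) (N <#> L)"
      "card (N <#> K) div card (N <#> L) = card K div card L"
    have "N \<subseteq> N <#> L"
      by (rule set_mult_upper[OF normal_imp_subgroup[OF N] chief_factorD(5)[OF c]])
    from chief_indices_inD[OF assms(3) above(1) this] show ?thesis using above(2) by simp
  next
    assume below: "chief_factor G (N \<inter> K) (N \<inter> L)"
      "card (N \<inter> K) div card (N \<inter> L) = card K div card L"
    have "card (N \<inter> K) div card (N \<inter> L) \<in> S" by (rule assms(4)[OF below(1)]) (use sub in auto)
    then show ?thesis using below(2) by simp
  qed
qed

text \<open>This is the reason why residuals behave well: a chief factor above \<open>M \<inter> N\<close> that lies below \<open>N\<close>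
  cannot also be projected below \<open>M\<close>, where it would collapse.\<close>
lemma (in group) chief_indices_in_Int:
  assumes fin: "finite (carrier G)" and M: "M \<lhd> G" and N: "N \<lhd> G"
    and "chief_indices_in G M S" "chief_indices_in G N S"
  shows "chief_indices_in G (M \<inter> N) S"
proof (rule chief_indices_in_extend[OF fin N assms(5)])
  fix K L assume c: "chief_factor G K L" and KN: "K \<subseteq> N" and L: "M \<inter> N \<inter> N \<subseteq> L"
  note cD = chief_factorD[OF c]
  show "card K div card L \<in> S"
  proof (rule chief_factor_projection[OF fin c M])
    assume above: "chief_factor G (M <#> K) (M <#> L)"
      "card (M <#> K) div card (M <#> L) = card K div card L"
    have "M \<subseteq> M <#> L"
      by (rule set_mult_upper[OF normal_imp_subgroup[OF M] cD(5)])
    from chief_indices_inD[OF assms(4) above(1) this] show ?thesis using above(2) by simp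
  next
    assume below: "chief_factor G (M \<inter> K) (M \<inter> L)"
      "card (M \<inter> K) div card (M \<inter> L) = card K div card L"
    have "M \<inter> K \<subseteq> M \<inter> L" using KN L by blast
    then show ?thesis using chief_factorD(3)[OF below(1)] by blast
  qed
qed

text \<open>The residual of the class of groups all of whose chief factors have their orders in \<open>S\<close>. The
  factor \<open>carrier G\<close> repeats the convention of \<open>residual\<close>.\<close>
definition chief_residual :: "('a, 'b) monoid_scheme \<Rightarrow> nat set \<Rightarrow> 'a set"
  where "chief_residual G S = carrier G \<inter> \<Inter> {N. N \<lhd> G \<and> chief_indices_in G N S}"

lemma (in group) chief_residual_least:
  assumes "N \<lhd> G" "chief_indices_in G N S" shows "chief_residual G S \<subseteq> N"
  using assms by (auto simp: chief_residual_def)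

lemma (in group) chief_residual_normal:
  assumes fin: "finite (carrier G)"
  shows "chief_residual G S \<lhd> G" "chief_indices_in G (chief_residual G S) S"
proof -
  let ?C = "{N. N \<lhd> G \<and> chief_indices_in G N S}"
  have "?C \<subseteq> Pow (carrier G)" by (auto dest!: normal_imp_subgroup subgroup.subset)
  then have finC: "finite ?C" using fin finite_subset by blast
  have "carrier G \<inter> \<Inter> D \<in> ?C" if "finite D" "D \<subseteq> ?C" for D
    using that
  proof (induction D rule: finite_induct)
    case empty
    have "chief_indices_in G (carrier G) S" unfolding chief_indices_in_def
    proof (intro allI impI, elim conjE)
      fix K L assume c: "chief_factor G K L" "carrier G \<subseteq> L"
      then have "K \<subseteq> L" using subgroup.subset[OF chief_factorD(4)[OF c(1)]] by blast
      then show "card K div card L \<in> S" using chief_factorD(3)[OF c(1)] by blast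
    qed
    then show ?case using normal_self by simp
  next
    case (insert N D)
    then have IH: "carrier G \<inter> \<Inter> D \<lhd> G" "chief_indices_in G (carrier G \<inter> \<Inter> D) S"
      and N: "N \<lhd> G" "chief_indices_in G N S" by simp_all
    have "carrier G \<inter> \<Inter> (insert N D) = N \<inter> (carrier G \<inter> \<Inter> D)" by auto
    then show ?case
      using normal_subgroup_intersect[OF N(1) IH(1)] chief_indices_in_Int[OF fin N(1) IH(1) N(2) IH(2)]
      by simp
  qed
  from this[OF finC subset_refl]
  show "chief_residual G S \<lhd> G" "chief_indices_in G (chief_residual G S) S"
    unfolding chief_residual_def by simp_all
qed

section \<open>Elements of prime power order\<close>

lemma (in group) pow_card_eq_one:
  assumes "subgroup K G" "y \<in> K" shows "y [^] card K = \<one>"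
proof -
  interpret K: group "G\<lparr>carrier := K\<rparr>" using assms(1) by (rule subgroup_imp_group)
  show ?thesis using K.pow_order_eq_1[of y] assms(2) by (simp add: order_def nat_pow_consistent[symmetric])
qed

lemma (in group) sylow_in_subgroup:
  assumes fin: "finite (carrier G)" and K: "subgroup K G" and "prime p" "card K = p ^ a * m"
  obtains P where "subgroup P G" "P \<subseteq> K" "card P = p ^ a"
proof -
  interpret K: group "G\<lparr>carrier := K\<rparr>" using K by (rule subgroup_imp_group)
  have finK: "finite K" using fin subgroup.subset[OF K] by (rule rev_finite_subset)
  have "\<exists>P. subgroup P (G\<lparr>carrier := K\<rparr>) \<and> card P = p ^ a"
    by (rule sylow_thm[OF assms(3) K.is_group, of a m]) (simp_all add: order_def assms(4) finK)
  then obtain P where P: "subgroup P (G\<lparr>carrier := K\<rparr>)" "card P = p ^ a" by blast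
  show ?thesis
    by (rule that[OF incl_subgroup[OF K P(1)] _ P(2)]) (use subgroup.subset[OF P(1)] in simp)
qed

lemma (in group) cauchy_in_subgroup:
  assumes fin: "finite (carrier G)" and K: "subgroup K G" and p: "prime p" "p dvd card K"
  obtains y where "y \<in> K" "y \<noteq> \<one>" "y [^] p = \<one>"
proof -
  obtain m where "card K = p ^ 1 * m" using p(2) by (auto elim: dvdE)
  from sylow_in_subgroup[OF fin K p(1) this]
  obtain P where P: "subgroup P G" "P \<subseteq> K" "card P = p" by auto
  have "P \<noteq> {\<one>}" using P(3) prime_gt_1_nat[OF p(1)] by auto
  then obtain y where y: "y \<in> P" "y \<noteq> \<one>" using subgroup.one_closed[OF P(1)] by auto
  show ?thesis
    by (rule that[of y]) (use y P(2) pow_card_eq_one[OF P(1) y(1)] P(3) in auto)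
qed

lemma (in group) eq_one_of_coprime_exponents:
  assumes "y \<in> carrier G" "y [^] m = \<one>" "y [^] n = \<one>" "coprime m (n::nat)"
  shows "y = \<one>"
proof -
  have "ord y dvd m" "ord y dvd n" using assms by (simp_all add: pow_eq_id)
  then have "ord y dvd 1" using assms(4) by (meson coprime_common_divisor_nat is_unit_gcd gcd_greatest coprime_def)
  then show ?thesis using ord_eq_1[OF assms(1)] by simp
qed

section \<open>Conjugation\<close>

lemma (in group) conjugation_hom:
  assumes "x \<in> carrier G" shows "group_hom G G (\<lambda>g. x \<otimes> g \<otimes> inv x)"
proof -
  have "x \<otimes> (g \<otimes> h) \<otimes> inv x = (x \<otimes> g \<otimes> inv x) \<otimes> (x \<otimes> h \<otimes> inv x)"
    if g: "g \<in> carrier G" and h: "h \<in> carrier G" for g h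
  proof -
    have "inv x \<otimes> (x \<otimes> (h \<otimes> inv x)) = h \<otimes> inv x"
      using assms h by (simp add: m_assoc[symmetric])
    then show ?thesis using assms g h by (simp add: m_assoc)
  qed
  then show ?thesis
    by (simp add: group_hom_def group_hom_axioms_def is_group hom_def Pi_iff assms)
qed

lemma (in group) conjugation_mult:
  assumes "a \<in> carrier G" "b \<in> carrier G" "z \<in> carrier G"
  shows "(a \<otimes> b) \<otimes> z \<otimes> inv (a \<otimes> b) = a \<otimes> (b \<otimes> z \<otimes> inv b) \<otimes> inv a"
  using assms by (simp add: m_assoc inv_mult_group)

section \<open>Chief factors of solvable groups\<close>

lemma (in group) derived_series_normal: "(derived G ^^ n) (carrier G) \<lhd> G"
  by (induction n) (auto simp: normal_self intro: derived_is_normal)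

lemma (in group) mem_derived:
  "a \<in> H \<Longrightarrow> b \<in> H \<Longrightarrow> a \<otimes> b \<otimes> inv a \<otimes> inv b \<in> derived G H"
  unfolding derived_def by (rule generate.incl) blast

lemma (in group) eq_if_commutator_one:
  assumes "a \<in> carrier G" "b \<in> carrier G" "a \<otimes> b \<otimes> inv a \<otimes> inv b = \<one>"
  shows "a \<otimes> b = b \<otimes> a"
proof -
  have "a \<otimes> b \<otimes> inv a = \<one> \<otimes> b"
    by (rule iffD1[OF inv_solve_right' assms(3)]) (use assms(1,2) in simp_all)
  then have "a \<otimes> b \<otimes> inv a = b" using assms(2) by simp
  then show ?thesis by (rule iffD1[OF inv_solve_right', rotated -1]) (use assms(1,2) in simp_all)
qed

lemma (in group) commutator_mem_normal:
  assumes K: "K \<lhd> G" and a: "a \<in> K" and b: "b \<in> carrier G"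
  shows "a \<otimes> b \<otimes> inv a \<otimes> inv b \<in> K"
proof -
  note sK = normal_imp_subgroup[OF K]
  have ac: "a \<in> carrier G" using a subgroup.mem_carrier[OF sK] by simp
  have "b \<otimes> inv a \<otimes> inv b \<in> K"
    using normal.inv_op_closed2[OF K b] subgroup.m_inv_closed[OF sK a] by simp
  then have "a \<otimes> (b \<otimes> inv a \<otimes> inv b) \<in> K" using subgroup.m_closed[OF sK a] by simp
  then show ?thesis using ac b by (simp add: m_assoc)
qed

text \<open>Let \<open>n\<close> be the first place where the derived series no longer contains \<open>K\<close>. Its \<open>n\<close>-th term
  meets \<open>K\<close> trivially by minimality and contains all commutators of elements of \<open>K\<close>.\<close>
lemma (in group) minimal_normal_abelian:
  assumes "solvable G" and c: "chief_factor G K {\<one>}" and ab: "a \<in> K" "b \<in> K"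
  shows "a \<otimes> b = b \<otimes> a"
proof -
  note cD = chief_factorD[OF c]
  let ?D = "\<lambda>n. (derived G ^^ n) (carrier G)"
  obtain N where N: "?D N = {\<one>}" using assms(1) solvable_iff_trivial_derived_seq by auto
  define n where "n = (LEAST n. \<not> K \<subseteq> ?D n)"
  have "\<not> K \<subseteq> ?D N" using N cD(3) by auto
  then have n: "\<not> K \<subseteq> ?D n" "\<And>m. m < n \<Longrightarrow> K \<subseteq> ?D m"
    unfolding n_def by (rule LeastI, use not_less_Least in blast)
  have "n \<noteq> 0" using n(1) subgroup.subset[OF cD(4)] by (intro notI) simp
  then obtain m where m: "n = Suc m" by (cases n) auto
  have Km: "K \<subseteq> ?D m" using n(2) m by simp
  have "K \<inter> ?D n = {\<one>} \<or> K \<inter> ?D n = K"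
    by (rule cD(6)[OF normal_subgroup_intersect[OF cD(1) derived_series_normal]])
      (use subgroup.one_closed[OF cD(4)] subgroup.one_closed[OF normal_imp_subgroup[OF derived_series_normal]] in auto)
  then have triv: "K \<inter> ?D n = {\<one>}" using n(1) by blast
  have c': "a \<in> carrier G" "b \<in> carrier G" using ab subgroup.mem_carrier[OF cD(4)] by auto
  have "a \<otimes> b \<otimes> inv a \<otimes> inv b \<in> ?D n"
    unfolding m using mem_derived[of a "?D m" b] Km ab by auto
  moreover have "a \<otimes> b \<otimes> inv a \<otimes> inv b \<in> K"
    by (rule commutator_mem_normal[OF cD(1) ab(1) c'(2)])
  ultimately have "a \<otimes> b \<otimes> inv a \<otimes> inv b = \<one>" using triv by blast
  then show ?thesis by (rule eq_if_commutator_one[OF c'])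
qed

lemma prime_power_if_unique_prime_divisor:
  fixes n :: nat
  assumes "n > 1" "prime p" "\<And>q. prime q \<Longrightarrow> q dvd n \<Longrightarrow> q = p"
  shows "\<exists>k>0. n = p ^ k"
proof -
  have "prime_factors n \<subseteq> {p}" using assms by (auto simp: prime_factors_dvd)
  then have "n = p ^ multiplicity p n"
    using prime_factorization_nat[of n] assms(1)
    by (cases "prime_factors n = {}") (auto simp: subset_singleton_iff prime_factorization_empty_iff)
  then show ?thesis using assms(1) by (metis less_numeral_extra(4) not_gr_zero power_0)
qed

text \<open>As \<open>K\<close> is abelian, its elements with \<open>y [^] p = \<one>\<close> form a subgroup, which is normal in \<open>G\<close>. It
  is nontrivial for a prime divisor \<open>p\<close> of the order of \<open>K\<close>, by Cauchy's theorem, and hence is all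
  of \<open>K\<close>. A second prime divisor would contradict Cauchy's theorem.\<close>
lemma (in group) minimal_normal_prime_power:
  assumes fin: "finite (carrier G)" and "solvable G" and c: "chief_factor G K {\<one>}"
  shows "\<exists>p k. prime p \<and> 0 < k \<and> card K = p ^ k"
proof -
  note cD = chief_factorD[OF c]
  note comm = minimal_normal_abelian[OF assms(2) c]
  have finK: "finite K" by (rule normal_finite[OF fin cD(1)])
  have "card {\<one>} < card K" by (rule psubset_card_mono[OF finK cD(3)])
  then have gt: "card K > 1" by simp
  then obtain p where p: "prime p" "p dvd card K" using prime_factor_nat[of "card K"] by auto
  let ?W = "{y \<in> K. y [^] p = \<one>}"
  have "?W \<lhd> G"
  proof (rule normal_invI)
    show "subgroup ?W G"
    proof (rule subgroupI)
      show "?W \<subseteq> carrier G" using subgroup.subset[OF cD(4)] by auto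
      show "?W \<noteq> {}" using subgroup.one_closed[OF cD(4)] by auto
      fix a b assume a: "a \<in> ?W" and b: "b \<in> ?W"
      then have ab: "a \<in> carrier G" "b \<in> carrier G" using subgroup.mem_carrier[OF cD(4)] by auto
      show "inv a \<in> ?W" using a ab subgroup.m_inv_closed[OF cD(4)] by (simp add: nat_pow_inv)
      show "a \<otimes> b \<in> ?W" using a b ab comm subgroup.m_closed[OF cD(4)]
        by (simp add: pow_mult_distrib)
    qed
    fix x h assume x: "x \<in> carrier G" and h: "h \<in> ?W"
    interpret cj: group_hom G G "\<lambda>g. x \<otimes> g \<otimes> inv x" by (rule conjugation_hom[OF x])
    have hc: "h \<in> carrier G" using h subgroup.mem_carrier[OF cD(4)] by auto
    have "(x \<otimes> h \<otimes> inv x) [^] p = \<one>"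
      using cj.hom_nat_pow[OF hc, of p] h x by simp
    then show "x \<otimes> h \<otimes> inv x \<in> ?W" using h normal.inv_op_closed2[OF cD(1) x] by simp
  qed
  then have "?W = {\<one>} \<or> ?W = K"
    by (rule cD(6)) (use subgroup.one_closed[OF cD(4)] in auto)
  moreover obtain y where "y \<in> K" "y \<noteq> \<one>" "y [^] p = \<one>"
    using cauchy_in_subgroup[OF fin cD(4) p] .
  ultimately have W: "y [^] p = \<one>" if "y \<in> K" for y using that by blast
  have "q = p" if q: "prime q" "q dvd card K" for q
  proof (rule ccontr)
    assume "q \<noteq> p"
    obtain z where z: "z \<in> K" "z \<noteq> \<one>" "z [^] q = \<one>"
      using cauchy_in_subgroup[OF fin cD(4) q] .
    have "coprime q p" using q(1) p(1) \<open>q \<noteq> p\<close> by (rule primes_coprime)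
    then show False
      using eq_one_of_coprime_exponents[OF subgroup.mem_carrier[OF cD(4) z(1)] z(3) W[OF z(1)]] z(2) by simp
  qed
  then show ?thesis using prime_power_if_unique_prime_divisor[OF gt p(1)] p(1) by blast
qed

lemma (in group) coset_image_self:
  assumes "subgroup L G" shows "(#>) L ` L = {L}"
proof -
  have "L #> x = L" if "x \<in> L" for x
    using coset_join2[OF subgroup.mem_carrier[OF assms that] assms that] .
  then show ?thesis using subgroup.one_closed[OF assms] by auto
qed

lemma (in group) chief_factor_iff_minimal_normal:
  assumes "K \<lhd> G" "L \<lhd> G" "L \<subseteq> K"
  shows "chief_factor (G Mod L) ((#>) L ` K) {\<one>\<^bsub>G Mod L\<^esub>} \<longleftrightarrow> chief_factor G K L"
  using chief_factor_coset_image_iff[OF assms(2,1,2) subset_refl assms(3)]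
  by (simp add: coset_image_self normal_imp_subgroup[OF assms(2)])

lemma (in group) card_coset_image_eq_index:
  assumes "finite (carrier G)" "subgroup K G" "subgroup L G" "L \<subseteq> K"
  shows "card ((#>) L ` K) = card K div card L"
  using order_chief_quotient[OF assms] by (simp add: FactGroup_restrict order_def)

lemma (in group) finite_FactGroup:
  "finite (carrier G) \<Longrightarrow> finite (carrier (G Mod N))"
  by (simp add: carrier_FactGroup)

lemma (in group) solvable_FactGroup:
  assumes "N \<lhd> G" "solvable G" shows "solvable (G Mod N)"
  by (rule group_hom.surj_hom_imp_solvable[OF quotient_hom[OF assms(1)] quotient_surj assms(2)])

theorem (in group) solvable_chief_index_prime_power:
  assumes fin: "finite (carrier G)" and s: "solvable G" and c: "chief_factor G K L"
  shows "\<exists>p k. prime p \<and> 0 < k \<and> card K div card L = p ^ k"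
proof -
  note cD = chief_factorD[OF c]
  have LK: "L \<subseteq> K" using cD(3) by blast
  interpret Q: group "G Mod L" by (rule normal.factorgroup_is_group[OF cD(2)])
  have "chief_factor (G Mod L) ((#>) L ` K) {\<one>\<^bsub>G Mod L\<^esub>}"
    using chief_factor_iff_minimal_normal[OF cD(1,2) LK] c by simp
  from Q.minimal_normal_prime_power[OF finite_FactGroup[OF fin] solvable_FactGroup[OF cD(2) s] this]
  show ?thesis using card_coset_image_eq_index[OF fin cD(4,5) LK] by simp
qed

section \<open>Chief factors of prime order\<close>

text \<open>Cauchy's theorem gives a subgroup of prime order in the quotient of \<open>K\<close> by \<open>L\<close>. It is normal by
  assumption, so it is the whole quotient.\<close>
lemma (in group) chief_index_prime:
  assumes fin: "finite (carrier G)" and c: "chief_factor G K L"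
    and normal: "\<And>M. subgroup M G \<Longrightarrow> L \<subseteq> M \<Longrightarrow> M \<subseteq> K \<Longrightarrow> M \<lhd> G"
  shows "prime (card K div card L)"
proof -
  note cD = chief_factorD[OF c]
  have LK: "L \<subseteq> K" using cD(3) by blast
  interpret Q: group "G Mod L" by (rule normal.factorgroup_is_group[OF cD(2)])
  let ?K = "(#>) L ` K"
  have cK: "card ?K = card K div card L" by (rule card_coset_image_eq_index[OF fin cD(4,5) LK])
  have "card L < card K" by (rule psubset_card_mono[OF normal_finite[OF fin cD(1)] cD(3)])
  moreover have "card ?K * card L = card K" by (rule card_coset_image[OF cD(5,4) LK])
  ultimately have "card ?K \<noteq> 1" by (intro notI) simp
  then obtain q where q: "prime q" "q dvd card ?K" using prime_factor_nat by blast
  then obtain m where "card ?K = q ^ 1 * m" by (auto elim: dvdE)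
  from Q.sylow_in_subgroup[OF finite_FactGroup[OF fin] coset_image_subgroup[OF cD(2,4)] q(1) this]
  obtain P where P: "subgroup P (G Mod L)" "P \<subseteq> ?K" "card P = q" by auto
  note im = Union_of_cosets[OF cD(2) P(1)]
  have sM: "subgroup (\<Union>P) G" by (rule normal.factgroup_subgroup_union_subgroup[OF cD(2) P(1)])
  have MK: "\<Union>P \<subseteq> K"
    using coset_image_subset_iff[OF cD(2,4) LK subgroup.subset[OF sM]] P(2) unfolding im(2) by blast
  have "\<Union>P = L \<or> \<Union>P = K" by (rule cD(6)[OF normal[OF sM im(1) MK] im(1) MK])
  moreover have "\<Union>P \<noteq> L"
  proof
    assume "\<Union>P = L"
    then have "P = {L}" using im(2) coset_image_self[OF cD(5)] by simp
    then show False using P(3) prime_gt_1_nat[OF q(1)] by simp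
  qed
  ultimately have "P = ?K" using im(2) by simp
  then show ?thesis using P(3) q(1) cK by simp
qed

lemma (in group) normal_if_derived_subset:
  assumes "subgroup M G" "derived G (carrier G) \<subseteq> M" shows "M \<lhd> G"
proof (rule normal_invI[OF assms(1)])
  fix x h assume x: "x \<in> carrier G" and h: "h \<in> M"
  have hc: "h \<in> carrier G" using subgroup.mem_carrier[OF assms(1) h] .
  have "x \<otimes> h \<otimes> inv x \<otimes> inv h \<in> M" using mem_derived[OF x hc] assms(2) by blast
  then have "x \<otimes> h \<otimes> inv x \<otimes> inv h \<otimes> h \<in> M" using h subgroup.m_closed[OF assms(1)] by blast
  then show "x \<otimes> h \<otimes> inv x \<in> M" using x hc by (simp add: m_assoc)
qed

text \<open>Conjugation by \<open>x\<close> sends the generator \<open>z\<close> to some \<open>z [^] t\<close>. It therefore raises every element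
  of \<open>Z\<close> to the \<open>t\<close>-th power, and so preserves every subgroup of \<open>Z\<close>.\<close>
lemma (in group) subgroup_of_normal_cyclic:
  assumes Z: "Z \<lhd> G" and z: "z \<in> Z" and cyc: "Z = range (\<lambda>i::int. z [^] i)"
    and V: "subgroup V G" "V \<subseteq> Z"
  shows "V \<lhd> G"
proof (rule normal_invI[OF V(1)])
  fix x v assume x: "x \<in> carrier G" and v: "v \<in> V"
  have zc: "z \<in> carrier G" using subgroup.mem_carrier[OF normal_imp_subgroup[OF Z] z] .
  interpret cj: group_hom G G "\<lambda>g. x \<otimes> g \<otimes> inv x" by (rule conjugation_hom[OF x])
  obtain i :: int where i: "v = z [^] i" using v V(2) cyc by blast
  have "x \<otimes> z \<otimes> inv x \<in> Z" by (rule normal.inv_op_closed2[OF Z x z])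
  then obtain t :: int where t: "x \<otimes> z \<otimes> inv x = z [^] t" using cyc by blast
  have "x \<otimes> v \<otimes> inv x = (z [^] t) [^] i" unfolding i t[symmetric] by (rule cj.hom_int_pow[OF zc])
  also have "\<dots> = v [^] t" unfolding i using zc by (simp add: int_pow_pow mult.commute)
  also have "\<dots> \<in> V" by (rule subgroup_int_pow_closed[OF V(1) v])
  finally show "x \<otimes> v \<otimes> inv x \<in> V" .
qed

lemma (in group) prime_order_generated:
  assumes Z: "subgroup Z G" "prime (card Z)" and z: "z \<in> Z" "z \<noteq> \<one>"
  shows "Z = range (\<lambda>i::int. z [^] i)"
proof -
  have zc: "z \<in> carrier G" using subgroup.mem_carrier[OF Z(1) z(1)] .
  have finZ: "finite Z" using prime_gt_0_nat[OF Z(2)] by (rule card_ge_0_finite)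
  let ?R = "range (\<lambda>i::int. z [^] i)"
  have R: "subgroup ?R G" by (rule subgroup_of_powers[OF zc])
  have RZ: "?R \<subseteq> Z" using subgroup_int_pow_closed[OF Z(1) z(1)] by blast
  have "card ?R dvd card Z" by (rule subgroup_card_dvd[OF R Z(1) RZ])
  moreover have "card ?R \<noteq> 1"
  proof
    assume "card ?R = 1"
    then obtain u where u: "?R = {u}" by (auto simp: card_1_singleton_iff)
    have "z [^] (0::int) \<in> ?R" "z [^] (1::int) \<in> ?R" by (rule rangeI)+
    then have "\<one> = u" "z = u" unfolding u using zc by (simp_all add: int_pow_1)
    then show False using z(2) by simp
  qed
  ultimately have "card ?R = card Z" using Z(2) unfolding prime_nat_iff by iprover
  then show ?thesis using card_subset_eq[OF finZ RZ] by simp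
qed

text \<open>The automorphism group of a cyclic group is abelian, so commutators act trivially on \<open>Z\<close>.\<close>
lemma (in group) derived_centralizes_prime_order:
  assumes Z: "Z \<lhd> G" "prime (card Z)" and d: "d \<in> derived G (carrier G)" and v: "v \<in> Z"
  shows "d \<otimes> v = v \<otimes> d"
proof -
  note sZ = normal_imp_subgroup[OF Z(1)]
  have "Z \<noteq> {\<one>}" using Z(2) by auto
  then obtain z where z: "z \<in> Z" "z \<noteq> \<one>" using subgroup.one_closed[OF sZ] by auto
  have zc: "z \<in> carrier G" using subgroup.mem_carrier[OF sZ z(1)] .
  note cyc = prime_order_generated[OF sZ Z(2) z]
  have pow: "\<exists>t::int. x \<otimes> z \<otimes> inv x = z [^] t" if "x \<in> carrier G" for x
    using normal.inv_op_closed2[OF Z(1) that z(1)] cyc by blast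
  let ?C = "{x \<in> carrier G. x \<otimes> z \<otimes> inv x = z}"
  have undo: "inv x \<otimes> (x \<otimes> z \<otimes> inv x) \<otimes> inv (inv x) = z" if "x \<in> carrier G" for x
    using conjugation_mult[OF inv_closed[OF that] that zc] that zc by simp
  have C: "subgroup ?C G"
  proof (rule subgroupI)
    have "\<one> \<in> ?C" using zc by simp
    then show "?C \<noteq> {}" by blast
    show "inv a \<in> ?C" if "a \<in> ?C" for a using undo[of a] that by simp
    show "a \<otimes> b \<in> ?C" if "a \<in> ?C" "b \<in> ?C" for a b
      using conjugation_mult[of a b z] that zc by simp
  qed simp
  have "w \<in> ?C" if "a \<in> carrier G" "b \<in> carrier G" and w: "w = a \<otimes> b \<otimes> inv a \<otimes> inv b" for a b w
  proof -
    \<comment> \<open>Conjugation by any element raises \<open>z\<close> to some power, so two such conjugations commute.\<close>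
    \<comment> \<open>With inverses, the commutator is a quotient of two products that act alike: \<open>w = inv q \<otimes> p\<close>.\<close>
    define a' b' where "a' = inv a" and "b' = inv b"
    then have ab: "a' \<in> carrier G" "b' \<in> carrier G" using that by simp_all
    obtain s :: int where s: "a' \<otimes> z \<otimes> inv a' = z [^] s" using pow[OF ab(1)] by blast
    obtain t :: int where t: "b' \<otimes> z \<otimes> inv b' = z [^] t" using pow[OF ab(2)] by blast
    interpret ca: group_hom G G "\<lambda>g. a' \<otimes> g \<otimes> inv a'" by (rule conjugation_hom[OF ab(1)])
    interpret cb: group_hom G G "\<lambda>g. b' \<otimes> g \<otimes> inv b'" by (rule conjugation_hom[OF ab(2)])
    define p q where "p = a' \<otimes> b'" and "q = b' \<otimes> a'"
    have pq: "p \<in> carrier G" "q \<in> carrier G" using ab by (simp_all add: p_def q_def)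
    have "p \<otimes> z \<otimes> inv p = (z [^] s) [^] t"
      unfolding p_def conjugation_mult[OF ab zc] t s[symmetric] by (rule ca.hom_int_pow[OF zc])
    also have "\<dots> = (z [^] t) [^] s" using zc by (simp add: int_pow_pow mult.commute)
    also have "\<dots> = q \<otimes> z \<otimes> inv q"
      unfolding q_def conjugation_mult[OF ab(2,1) zc] s t[symmetric]
      by (rule cb.hom_int_pow[OF zc, symmetric])
    finally have eq: "p \<otimes> z \<otimes> inv p = q \<otimes> z \<otimes> inv q" .
    have w': "w = inv q \<otimes> p"
      using that(1,2) by (simp add: w p_def q_def a'_def b'_def inv_mult_group m_assoc)
    have "w \<otimes> z \<otimes> inv w = z"
      unfolding w' conjugation_mult[OF inv_closed[OF pq(2)] pq(1) zc] eq by (rule undo[OF pq(2)])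
    then show ?thesis using pq w' by simp
  qed
  then have "derived_set G (carrier G) \<subseteq> ?C" by (intro UN_least) simp
  then have "derived G (carrier G) \<subseteq> ?C" unfolding derived_def by (rule generate_subgroup_incl[OF _ C])
  then have dC: "d \<in> carrier G" "d \<otimes> z \<otimes> inv d = z" using d by auto
  interpret cd: group_hom G G "\<lambda>g. d \<otimes> g \<otimes> inv d" by (rule conjugation_hom[OF dC(1)])
  obtain i :: int where i: "v = z [^] i" using v cyc by blast
  have vc: "v \<in> carrier G" using subgroup.mem_carrier[OF sZ v] .
  have "d \<otimes> v \<otimes> inv d = (d \<otimes> z \<otimes> inv d) [^] i" unfolding i by (rule cd.hom_int_pow[OF zc])
  then have "d \<otimes> v \<otimes> inv d = v" using dC(2) i by simp
  then have "d \<otimes> v \<otimes> inv d \<otimes> d = v \<otimes> d" by simp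
  then show ?thesis using dC(1) vc by (simp add: m_assoc)
qed

section \<open>The derived subgroup of a \<open>p\<close>-supersolvable group\<close>

definition p_chief_indices :: "nat \<Rightarrow> nat set"
  where "p_chief_indices p = {n. n = p \<or> \<not> p dvd n}"

lemma (in group) derived_commutator_mem:
  assumes fin: "finite (carrier G)" and c: "chief_factor G A B" and "prime (card A div card B)"
    and d: "d \<in> derived G (carrier G)" and a: "a \<in> A"
  shows "d \<otimes> a \<otimes> inv d \<otimes> inv a \<in> B"
proof -
  note cD = chief_factorD[OF c]
  have BA: "B \<subseteq> A" using cD(3) by blast
  interpret h: group_hom G "G Mod B" "(#>) B" by (rule quotient_hom[OF cD(2)])
  have dc: "d \<in> carrier G" using d derived_in_carrier[of "carrier G"] by blast
  have ac: "a \<in> carrier G" using subgroup.mem_carrier[OF cD(4) a] .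
  have "derived (G Mod B) (carrier (G Mod B)) = (#>) B ` derived G (carrier G)"
    using h.derived_img[of "carrier G"] by (simp add: quotient_surj)
  then have hd: "B #> d \<in> derived (G Mod B) (carrier (G Mod B))" using d by blast
  have "prime (card ((#>) B ` A))"
    using assms(3) card_coset_image_eq_index[OF fin cD(4,5) BA] by simp
  from h.H.derived_centralizes_prime_order[OF coset_image_normal[OF cD(2,1)] this hd, of "B #> a"]
  have comm: "(B #> d) \<otimes>\<^bsub>G Mod B\<^esub> (B #> a) = (B #> a) \<otimes>\<^bsub>G Mod B\<^esub> (B #> d)" using a by blast
  have hc: "B #> d \<in> carrier (G Mod B)" "B #> a \<in> carrier (G Mod B)"
    using h.hom_closed dc ac by blast+
  have "B #> (d \<otimes> a \<otimes> inv d \<otimes> inv a) = (B #> d) \<otimes>\<^bsub>G Mod B\<^esub> (B #> a)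
      \<otimes>\<^bsub>G Mod B\<^esub> inv\<^bsub>G Mod B\<^esub> (B #> d) \<otimes>\<^bsub>G Mod B\<^esub> inv\<^bsub>G Mod B\<^esub> (B #> a)"
    using dc ac by (simp only: h.hom_mult h.hom_inv m_closed inv_closed)
  also have "\<dots> = \<one>\<^bsub>G Mod B\<^esub>"
    unfolding comm using hc by (simp only: h.H.m_assoc h.H.r_inv h.H.inv_closed h.H.m_closed h.H.r_one)
  finally have "B #> (d \<otimes> a \<otimes> inv d \<otimes> inv a) = B" by simp
  then show ?thesis
    by (rule iffD1[OF quotient_eq_one_iff[OF cD(2)], rotated]) (use dc ac in simp)
qed

lemma (in group) conjugation_pow:
  assumes c: "y \<in> carrier G" "a \<in> carrier G" "c \<in> carrier G"
    and "y \<otimes> a \<otimes> inv y = c \<otimes> a" "y \<otimes> c = c \<otimes> y"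
  shows "y [^] (n::nat) \<otimes> a \<otimes> inv (y [^] n) = c [^] n \<otimes> a"
proof (induction n)
  case (Suc n)
  interpret cj: group_hom G G "\<lambda>g. y \<otimes> g \<otimes> inv y" by (rule conjugation_hom[OF c(1)])
  have yc: "y \<otimes> c \<otimes> inv y = c" unfolding assms(5) using c by (simp add: m_assoc)
  have "y [^] Suc n \<otimes> a \<otimes> inv (y [^] Suc n) = y \<otimes> (y [^] n \<otimes> a \<otimes> inv (y [^] n)) \<otimes> inv y"
    unfolding nat_pow_Suc2[OF c(1)] using c by (simp only: conjugation_mult nat_pow_closed)
  also have "\<dots> = y \<otimes> (c [^] n \<otimes> a) \<otimes> inv y" unfolding Suc.IH ..
  also have "\<dots> = (y \<otimes> c [^] n \<otimes> inv y) \<otimes> (y \<otimes> a \<otimes> inv y)"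
    using c by (simp only: cj.hom_mult nat_pow_closed)
  also have "\<dots> = c [^] n \<otimes> (c \<otimes> a)" using cj.hom_nat_pow[OF c(3), of n] unfolding yc assms(4) by simp
  also have "\<dots> = c [^] Suc n \<otimes> a" using c by (simp add: m_assoc)
  finally show ?case .
qed (use c in simp)

text \<open>By induction \<open>y\<close> centralizes the next term \<open>B\<close> of a chief series of \<open>G\<close> through the \<open>p\<close>-group
  \<open>A\<close>. The factor has order \<open>p\<close>, so the derived subgroup centralizes it and \<open>y\<close> moves \<open>a\<close> to
  \<open>c \<otimes> a\<close> with \<open>c \<in> B\<close>. Then the \<open>n\<close>-th power of \<open>y\<close> moves \<open>a\<close> to \<open>c [^] n \<otimes> a\<close>; for
  \<open>n = card Q\<close> this forces \<open>c [^] n = \<one>\<close>, and \<open>c\<close> is trivial because its order is also a power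
  of \<open>p\<close>.\<close>
lemma (in group) coprime_centralizes:
  assumes fin: "finite (carrier G)" and p: "prime p"
    and idx: "chief_indices_in G {\<one>} (p_chief_indices p)"
    and Q: "subgroup Q G" "Q \<subseteq> derived G (carrier G)" "\<not> p dvd card Q"
    and y: "y \<in> Q"
  shows "A \<lhd> G \<Longrightarrow> card A = p ^ k \<Longrightarrow> a \<in> A \<Longrightarrow> y \<otimes> a = a \<otimes> y"
proof (induction "card A" arbitrary: A k a rule: less_induct)
  case less
  note sA = normal_imp_subgroup[OF less.prems(1)]
  have yc: "y \<in> carrier G" by (rule subgroup.mem_carrier[OF Q(1) y])
  have ac: "a \<in> carrier G" by (rule subgroup.mem_carrier[OF sA less.prems(3)])
  show ?case
  proof (cases "A = {\<one>}")
    case True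
    then have "a = \<one>" using less.prems(3) by simp
    then show ?thesis using yc by simp
  next
    case False
    then have "{\<one>} \<subset> A" using subgroup.one_closed[OF sA] by blast
    from chief_factor_below_exists[OF fin one_is_normal less.prems(1) this]
    obtain B where B: "chief_factor G A B" by blast
    note cD = chief_factorD[OF B]
    have BA: "B \<subseteq> A" using cD(3) by blast
    have "card B dvd card A" by (rule subgroup_card_dvd[OF cD(5,4) BA])
    then obtain j where j: "card B = p ^ j" using less.prems(2) p divides_primepow_nat by metis
    have lt: "card B < card A" by (rule psubset_card_mono[OF normal_finite[OF fin less.prems(1)] cD(3)])
    have jk: "j < k" using lt unfolding j less.prems(2) using prime_gt_1_nat[OF p] by simp
    have q: "card A div card B = p ^ (k - j)"
      unfolding j less.prems(2) using jk prime_gt_0_nat[OF p] by (simp add: power_diff)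
    have "card A div card B \<in> p_chief_indices p"
      by (rule chief_indices_inD[OF idx B]) (use subgroup.one_closed[OF cD(5)] in simp)
    moreover have "p dvd card A div card B" unfolding q using jk by simp
    ultimately have "prime (card A div card B)" using p by (simp add: p_chief_indices_def)
    from derived_commutator_mem[OF fin B this _ less.prems(3)]
    have cB: "y \<otimes> a \<otimes> inv y \<otimes> inv a \<in> B" using y Q(2) by blast
    define c where "c = y \<otimes> a \<otimes> inv y \<otimes> inv a"
    have cc: "c \<in> carrier G" using yc ac by (simp add: c_def)
    have "y \<otimes> c = c \<otimes> y" using less.hyps[OF lt cD(2) j] cB by (simp add: c_def)
    moreover have "y \<otimes> a \<otimes> inv y = c \<otimes> a" using yc ac by (simp add: c_def m_assoc)
    ultimately have "y [^] card Q \<otimes> a \<otimes> inv (y [^] card Q) = c [^] card Q \<otimes> a"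
      using conjugation_pow[OF yc ac cc] by blast
    then have "c [^] card Q \<otimes> a = a" using ac pow_card_eq_one[OF Q(1) y] by simp
    then have 1: "c [^] card Q = \<one>" using ac cc by simp
    have 2: "c [^] card B = \<one>" using pow_card_eq_one[OF cD(5)] cB by (simp add: c_def)
    have "coprime (card Q) (card B)"
      unfolding j using Q(3) p by (metis coprime_commute coprime_power_right_iff prime_imp_coprime)
    from eq_one_of_coprime_exponents[OF cc 1 2 this] have "c = \<one>" .
    then show ?thesis using eq_if_commutator_one[OF yc ac] by (simp add: c_def)
  qed
qed

text \<open>Let \<open>A\<close> be a largest normal \<open>p\<close>-subgroup of \<open>G\<close> inside the derived subgroup. If it is not
  everything, a chief factor \<open>B / A\<close> inside the derived subgroup has order a power of a prime \<open>q\<close>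
  other than \<open>p\<close>. A Sylow \<open>q\<close>-subgroup \<open>Q\<close> of \<open>B\<close> centralizes \<open>A\<close>, so \<open>B\<close> is the direct product of
  \<open>A\<close> and \<open>Q\<close>. Hence \<open>Q\<close> consists of all elements of \<open>B\<close> whose order divides \<open>card Q\<close>, and
  is normal in \<open>G\<close>, contrary to the absence of normal \<open>p'\<close>-subgroups.\<close>
lemma (in group) derived_p_group:
  assumes fin: "finite (carrier G)" and s: "solvable G" and p: "prime p"
    and idx: "chief_indices_in G {\<one>} (p_chief_indices p)"
    and core: "\<And>N. N \<lhd> G \<Longrightarrow> \<not> p dvd card N \<Longrightarrow> N = {\<one>}"
  shows "\<exists>k. card (derived G (carrier G)) = p ^ k"
proof -
  let ?D = "derived G (carrier G)"
  have D: "?D \<lhd> G" by (rule derived_is_normal[OF normal_self])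
  note sD = normal_imp_subgroup[OF D]
  let ?P = "\<lambda>A. A \<lhd> G \<and> A \<subseteq> ?D \<and> (\<exists>k. card A = p ^ k)"
  have "card {\<one>} = p ^ 0" by simp
  then have P1: "?P {\<one>}" using one_is_normal subgroup.one_closed[OF sD] by blast
  have "\<forall>A. ?P A \<longrightarrow> card A < Suc (card ?D)"
    using card_mono[OF normal_finite[OF fin D]] by (simp add: less_Suc_eq_le)
  from ex_has_greatest_nat[of ?P, OF P1 this]
  obtain A where A: "?P A" and max: "\<And>A'. ?P A' \<Longrightarrow> card A' \<le> card A" by iprover
  then obtain a where An: "A \<lhd> G" and AD: "A \<subseteq> ?D" and a: "card A = p ^ a" by blast
  note sA = normal_imp_subgroup[OF An]
  have "A = ?D"
  proof (rule ccontr)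
    assume "A \<noteq> ?D"
    then have "A \<subset> ?D" using AD by blast
    from chief_factor_above_exists[OF fin An D this]
    obtain B where B: "chief_factor G B A" and BD: "B \<subseteq> ?D" by blast
    note cD = chief_factorD[OF B]
    have AB: "A \<subseteq> B" using cD(3) by blast
    obtain q k where q: "prime q" "0 < k" "card B div card A = q ^ k"
      using solvable_chief_index_prime_power[OF fin s B] by blast
    have cB: "card B = q ^ k * p ^ a"
      using subgroup_card_dvd[OF sA cD(4) AB] q(3) a by (metis dvd_div_mult_self)
    have "q \<noteq> p"
    proof
      assume "q = p"
      then have "card B = p ^ (k + a)" using cB by (simp add: power_add)
      then have "?P B" using cD(1) BD by blast
      then have "card B \<le> card A" by (rule max)
      moreover have "card A < card B" by (rule psubset_card_mono[OF normal_finite[OF fin cD(1)] cD(3)])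
      ultimately show False by simp
    qed
    obtain Q where Q: "subgroup Q G" "Q \<subseteq> B" "card Q = q ^ k"
      using sylow_in_subgroup[OF fin cD(4) q(1) cB] .
    have "coprime p q" using p q(1) \<open>q \<noteq> p\<close> by (simp add: primes_coprime)
    then have cop: "coprime (q ^ k) (p ^ a)" by (simp add: coprime_commute)
    have pq: "\<not> p dvd card Q" unfolding Q(3)
      using p q(1) \<open>q \<noteq> p\<close> prime_dvd_power primes_dvd_imp_eq by metis
    have QD: "Q \<subseteq> ?D" using Q(2) BD by blast
    have cent: "y \<otimes> x = x \<otimes> y" if "y \<in> Q" "x \<in> A" for x y
      by (rule coprime_centralizes[OF fin p idx Q(1) QD pq that(1) An a that(2)])
    have AQ: "A <#> Q = B"
    proof (rule card_seteq[OF normal_finite[OF fin cD(1)] set_mult_least[OF cD(4) AB Q(2)]])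
      \<comment> \<open>The coprime orders of \<open>A\<close> and \<open>Q\<close> both divide that of their product.\<close>
      have "subgroup (A <#> Q) G"
        using second_isomorphism_grp.normal_set_mult_subgroup[of A G Q] An Q(1)
        by (simp add: second_isomorphism_grp_def second_isomorphism_grp_axioms_def)
      from subgroup_card_dvd[OF sA this] subgroup_card_dvd[OF Q(1) this] set_mult_upper[OF sA Q(1)]
      have "p ^ a dvd card (A <#> Q)" "q ^ k dvd card (A <#> Q)" using a Q(3) by simp_all
      then have "q ^ k * p ^ a dvd card (A <#> Q)" using cop by (simp add: divides_mult)
      moreover have "0 < card (A <#> Q)" by (rule subgroup_card_pos[OF fin]) fact
      ultimately show "card B \<le> card (A <#> Q)" unfolding cB by (rule dvd_imp_le)
    qed
    have Qeq: "Q = {b \<in> B. b [^] card Q = \<one>}"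
    proof (intro equalityI subsetI)
      fix b assume "b \<in> Q"
      then show "b \<in> {b \<in> B. b [^] card Q = \<one>}" using Q(2) pow_card_eq_one[OF Q(1)] by blast
    next
      fix b assume "b \<in> {b \<in> B. b [^] card Q = \<one>}"
      then have b: "b \<in> B" "b [^] card Q = \<one>" by auto
      then obtain x y where xy: "x \<in> A" "y \<in> Q" "b = x \<otimes> y"
        using AQ mem_set_mult_iff[of b A Q] by blast
      have c: "x \<in> carrier G" "y \<in> carrier G"
        using subgroup.mem_carrier[OF sA xy(1)] subgroup.mem_carrier[OF Q(1) xy(2)] .
      have "b [^] card Q = x [^] card Q \<otimes> y [^] card Q"
        unfolding xy(3) by (rule pow_mult_distrib[OF _ c]) (rule cent[OF xy(2,1), symmetric])
      then have "x [^] card Q = \<one>" using b(2) pow_card_eq_one[OF Q(1) xy(2)] c by simp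
      moreover have "x [^] card A = \<one>" by (rule pow_card_eq_one[OF sA xy(1)])
      ultimately have "x = \<one>"
        using eq_one_of_coprime_exponents[OF c(1)] cop unfolding Q(3) a by blast
      then show "b \<in> Q" using xy c by simp
    qed
    have "Q \<lhd> G"
    proof (rule normal_invI[OF Q(1)])
      fix x h assume x: "x \<in> carrier G" and h: "h \<in> Q"
      interpret cj: group_hom G G "\<lambda>g. x \<otimes> g \<otimes> inv x" by (rule conjugation_hom[OF x])
      have hc: "h \<in> carrier G" by (rule subgroup.mem_carrier[OF Q(1) h])
      have hB: "h \<in> B" using h Q(2) by blast
      have "(x \<otimes> h \<otimes> inv x) [^] card Q = x \<otimes> h [^] card Q \<otimes> inv x"
        by (rule cj.hom_nat_pow[OF hc, symmetric])
      also have "\<dots> = \<one>" using pow_card_eq_one[OF Q(1) h] x by simp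
      finally show "x \<otimes> h \<otimes> inv x \<in> Q"
        using normal.inv_op_closed2[OF cD(1) x hB] by (subst Qeq) simp
    qed
    then have "Q = {\<one>}" using core pq by blast
    then have "q ^ k = 1" using Q(3) by simp
    then show False using q(1,2) by simp
  qed
  then show ?thesis using a by blast
qed

text \<open>Chief factors above the derived subgroup have prime order, as all intermediate subgroups are
  normal. Those below it have order a nontrivial power of \<open>p\<close>, and this power is \<open>p\<close>
  by \<open>p\<close>-supersolvability.\<close>
theorem (in group) p_supersolvable_core_free_imp_prime_indices:
  assumes fin: "finite (carrier G)" and s: "solvable G" and p: "prime p"
    and idx: "chief_indices_in G {\<one>} (p_chief_indices p)"
    and core: "\<And>N. N \<lhd> G \<Longrightarrow> \<not> p dvd card N \<Longrightarrow> N = {\<one>}"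
  shows "chief_indices_in G {\<one>} {n. prime n}"
proof -
  let ?D = "derived G (carrier G)"
  have D: "?D \<lhd> G" by (rule derived_is_normal[OF normal_self])
  note sD = normal_imp_subgroup[OF D]
  obtain k where k: "card ?D = p ^ k" using derived_p_group[OF assms] by blast
  show ?thesis
  proof (rule chief_indices_in_extend[OF fin D])
    show "chief_indices_in G ?D {n. prime n}" unfolding chief_indices_in_def
    proof (intro allI impI, elim conjE, rule CollectI)
      fix K L assume c: "chief_factor G K L" and DL: "?D \<subseteq> L"
      show "prime (card K div card L)"
        by (rule chief_index_prime[OF fin c], rule normal_if_derived_subset) (use DL in auto)
    qed
  next
    fix K L assume c: "chief_factor G K L" and KD: "K \<subseteq> ?D"
    note cD = chief_factorD[OF c]
    have LK: "L \<subseteq> K" using cD(3) by blast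
    have dv: "card L dvd card K" by (rule subgroup_card_dvd[OF cD(5,4) LK])
    have "card K dvd p ^ k" unfolding k[symmetric] by (rule subgroup_card_dvd[OF cD(4) sD KD])
    moreover have "card K div card L dvd card K" using dv by (metis dvd_div_mult_self dvd_triv_left)
    ultimately have "card K div card L dvd p ^ k" by (rule dvd_trans[rotated])
    then obtain j where j: "card K div card L = p ^ j" using p divides_primepow_nat by metis
    have "card L < card K" by (rule psubset_card_mono[OF normal_finite[OF fin cD(1)] cD(3)])
    then have "card K div card L \<noteq> 1" using dv by (metis dvd_div_mult_self mult_1 less_irrefl)
    then have "j \<noteq> 0" using j by (intro notI) simp
    then have "p dvd card K div card L" unfolding j by simp
    moreover have "card K div card L \<in> p_chief_indices p"
      by (rule chief_indices_inD[OF idx c]) (use subgroup.one_closed[OF cD(5)] in simp)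
    ultimately show "card K div card L \<in> {n. prime n}" using p by (simp add: p_chief_indices_def)
  qed
qed

section \<open>Supersolvable groups\<close>

lemma (in group) p_supersolvable_iff_chief_indices:
  assumes "finite (carrier G)"
  shows "p_supersolvable p G \<longleftrightarrow> chief_indices_in G {\<one>} (p_chief_indices p)"
proof -
  have "(chief_factor G K L \<longrightarrow> Coset.order ((G\<lparr>carrier := K\<rparr>) Mod L) = p
        \<or> \<not> p dvd Coset.order ((G\<lparr>carrier := K\<rparr>) Mod L)) \<longleftrightarrow>
      (chief_factor G K L \<and> {\<one>} \<subseteq> L \<longrightarrow> card K div card L \<in> p_chief_indices p)" for K L
  proof (cases "chief_factor G K L")
    case True
    note cD = chief_factorD[OF True]
    have "Coset.order ((G\<lparr>carrier := K\<rparr>) Mod L) = card K div card L"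
      by (rule order_chief_quotient[OF assms cD(4,5)]) (use cD(3) in blast)
    then show ?thesis using True subgroup.one_closed[OF cD(5)] by (simp add: p_chief_indices_def)
  qed simp
  then show ?thesis
    using assms is_group by (simp only: p_supersolvable_def chief_indices_in_def simp_thms)
qed

lemma (in group) cyclic_subgroup_iff:
  assumes "subgroup Z G"
  shows "cyclic_group (G\<lparr>carrier := Z\<rparr>) \<longleftrightarrow> (\<exists>z\<in>Z. Z = range (\<lambda>i::int. z [^] i))"
proof -
  interpret Z: group "G\<lparr>carrier := Z\<rparr>" by (rule subgroup_imp_group[OF assms])
  have "range (\<lambda>i::int. z [^]\<^bsub>G\<lparr>carrier := Z\<rparr>\<^esub> i) = range (\<lambda>i::int. z [^] i)" if "z \<in> Z" for z
    using int_pow_consistent[OF assms that] by simp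
  then show ?thesis unfolding Z.cyclic_group by (intro bex_cong) simp_all
qed

lemma (in group) normal_if_over_cyclic:
  assumes K: "K \<lhd> G" and N: "N \<lhd> G" "K \<subseteq> N"
    and cyc: "cyclic_group ((G\<lparr>carrier := N\<rparr>) Mod K)"
    and M: "subgroup M G" "K \<subseteq> M" "M \<subseteq> N"
  shows "M \<lhd> G"
proof -
  interpret Q: group "G Mod K" by (rule normal.factorgroup_is_group[OF K])
  let ?Z = "(#>) K ` N"
  have Z: "?Z \<lhd> G Mod K" by (rule coset_image_normal[OF K N(1)])
  note sZ = normal_imp_subgroup[OF Z]
  obtain z where z: "z \<in> ?Z" and "?Z = range (\<lambda>i::int. z [^]\<^bsub>G Mod K\<^esub> i)"
    using iffD1[OF Q.cyclic_subgroup_iff[OF sZ] cyc[unfolded FactGroup_restrict]] by (rule bexE)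
  from Q.subgroup_of_normal_cyclic[OF Z this coset_image_subgroup[OF K M(1)] image_mono[OF M(3)]]
  show ?thesis by (rule normal_of_coset_image_normal[OF K M(1,2)])
qed

text \<open>A chief factor below \<open>N\<close> projects either below the previous term \<open>K\<close> of the series, or between
  \<open>K\<close> and \<open>N\<close>. In the second case every intermediate subgroup is normal in \<open>G\<close> because the quotient
  of \<open>N\<close> by \<open>K\<close> is cyclic, so the factor has prime order.\<close>
lemma (in group) supersolvable_seq_chief_index_prime:
  assumes fin: "finite (carrier G)" and "supersolvable_seq G N"
  shows "chief_factor G A B \<Longrightarrow> A \<subseteq> N \<Longrightarrow> prime (card A div card B)"
  using assms(2)
proof (induction arbitrary: A B rule: supersolvable_seq.induct)
  case unity
  note cD = chief_factorD(3,5)[OF unity(1)]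
  have "B \<subset> {\<one>}" using cD(1) unity(2) by (rule psubset_subset_trans)
  then show ?case using subgroup.one_closed[OF cD(2)] by (auto simp: psubset_eq subset_singleton_iff)
next
  case (extension K N)
  note cD = chief_factorD[OF extension.prems(1)]
  note sK = normal_imp_subgroup[OF extension.hyps(2)]
  show ?case
  proof (rule chief_factor_projection[OF fin extension.prems(1) extension.hyps(2)])
    assume above: "chief_factor G (K <#> A) (K <#> B)"
      "card (K <#> A) div card (K <#> B) = card A div card B"
    have KB: "K \<subseteq> K <#> B" by (rule set_mult_upper[OF sK cD(5)])
    have KA: "K <#> A \<subseteq> N"
      by (rule set_mult_least[OF normal_imp_subgroup[OF extension.hyps(3)] extension.hyps(4) extension.prems(2)])
    have "prime (card (K <#> A) div card (K <#> B))"
    proof (rule chief_index_prime[OF fin above(1)])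
      fix M assume M: "subgroup M G" "K <#> B \<subseteq> M" "M \<subseteq> K <#> A"
      show "M \<lhd> G"
        by (rule normal_if_over_cyclic[OF extension.hyps(2-5) M(1) order_trans[OF KB M(2)] order_trans[OF M(3) KA]])
    qed
    then show ?thesis using above(2) by simp
  next
    assume below: "chief_factor G (K \<inter> A) (K \<inter> B)"
      "card (K \<inter> A) div card (K \<inter> B) = card A div card B"
    show ?thesis using extension.IH[OF below(1)] below(2) by simp
  qed
qed

lemma (in group) cyclic_quotient_if_prime_index:
  assumes fin: "finite (carrier G)" and K: "K \<lhd> G" and N: "N \<lhd> G" "K \<subseteq> N"
    and pr: "prime (card N div card K)"
  shows "cyclic_group ((G\<lparr>carrier := N\<rparr>) Mod K)"
proof -
  interpret Q: group "G Mod K" by (rule normal.factorgroup_is_group[OF K])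
  let ?Z = "(#>) K ` N"
  note sN = normal_imp_subgroup[OF N(1)]
  have sZ: "subgroup ?Z (G Mod K)" by (rule coset_image_subgroup[OF K sN])
  have prZ: "prime (card ?Z)"
    using pr card_coset_image_eq_index[OF fin sN normal_imp_subgroup[OF K] N(2)] by simp
  then have "?Z \<noteq> {\<one>\<^bsub>G Mod K\<^esub>}" by (intro notI) simp
  then obtain z where z: "z \<in> ?Z" "z \<noteq> \<one>\<^bsub>G Mod K\<^esub>" using subgroup.one_closed[OF sZ] by auto
  from Q.prime_order_generated[OF sZ prZ z] z(1)
  show ?thesis unfolding FactGroup_restrict Q.cyclic_subgroup_iff[OF sZ] by (rule bexI)
qed

text \<open>For the converse, a largest normal subgroup that is reached by a supersolvable series is all of
  \<open>G\<close>, since a chief factor on top of it is cyclic of prime order and would extend the series.\<close>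
theorem (in group) supersolvable_iff_chief_indices:
  assumes fin: "finite (carrier G)"
  shows "supersolvable G \<longleftrightarrow> chief_indices_in G {\<one>} {n. prime n}"
proof
  assume "supersolvable G"
  then have seq: "supersolvable_seq G (carrier G)" by (simp add: supersolvable_def)
  show "chief_indices_in G {\<one>} {n. prime n}" unfolding chief_indices_in_def
  proof (intro allI impI, elim conjE, rule CollectI)
    fix K L assume c: "chief_factor G K L"
    show "prime (card K div card L)"
      by (rule supersolvable_seq_chief_index_prime[OF fin seq c])
        (rule subgroup.subset[OF chief_factorD(4)[OF c]])
  qed
next
  assume idx: "chief_indices_in G {\<one>} {n. prime n}"
  let ?P = "\<lambda>N. N \<lhd> G \<and> supersolvable_seq G N"
  have P1: "?P {\<one>}" using one_is_normal supersolvable_seq.unity by blast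
  have "\<forall>N. ?P N \<longrightarrow> card N < Suc (card (carrier G))"
    using card_mono[OF fin subgroup.subset[OF normal_imp_subgroup]] by (simp add: less_Suc_eq_le)
  from ex_has_greatest_nat[of ?P, OF P1 this]
  obtain N where N: "?P N" and max: "\<And>N'. ?P N' \<Longrightarrow> card N' \<le> card N" by iprover
  then have Nn: "N \<lhd> G" and seq: "supersolvable_seq G N" by simp_all
  have "N = carrier G"
  proof (rule ccontr)
    assume "N \<noteq> carrier G"
    then have "N \<subset> carrier G" using subgroup.subset[OF normal_imp_subgroup[OF Nn]] by blast
    from chief_factor_above_exists[OF fin Nn normal_self this]
    obtain K where c: "chief_factor G K N" by blast
    note cD = chief_factorD[OF c]
    have NK: "N \<subseteq> K" using cD(3) by blast
    have "card K div card N \<in> {n. prime n}"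
      by (rule chief_indices_inD[OF idx c]) (use subgroup.one_closed[OF cD(5)] in simp)
    then have "cyclic_group ((G\<lparr>carrier := K\<rparr>) Mod N)"
      using cyclic_quotient_if_prime_index[OF fin Nn cD(1) NK] by simp
    then have "?P K" using supersolvable_seq.extension[OF seq Nn cD(1) NK] cD(1) by simp
    then have "card K \<le> card N" by (rule max)
    moreover have "card N < card K" by (rule psubset_card_mono[OF normal_finite[OF fin cD(1)] cD(3)])
    ultimately show False by simp
  qed
  then show "supersolvable G" using seq fin is_group by (simp add: supersolvable_def)
qed

section \<open>Residuals\<close>

lemma (in group) residual_eq_chief_residual:
  assumes "\<And>N. N \<lhd> G \<Longrightarrow> F (G Mod N) \<longleftrightarrow> chief_indices_in G N S"
  shows "residual F G = chief_residual G S"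
proof -
  have "{N. N \<lhd> G \<and> F (G Mod N)} = {N. N \<lhd> G \<and> chief_indices_in G N S}" using assms by blast
  then show ?thesis by (simp only: residual_def chief_residual_def)
qed

lemma (in group) residual_supersolvable:
  assumes "finite (carrier G)"
  shows "residual supersolvable G = chief_residual G {n. prime n}"
proof (rule residual_eq_chief_residual)
  fix N assume N: "N \<lhd> G"
  interpret Q: group "G Mod N" by (rule normal.factorgroup_is_group[OF N])
  show "supersolvable (G Mod N) \<longleftrightarrow> chief_indices_in G N {n. prime n}"
    using Q.supersolvable_iff_chief_indices[OF finite_FactGroup[OF assms]]
      chief_indices_in_quotient_iff[OF assms N] by (simp only:)
qed

lemma (in group) residual_p_supersolvable:
  assumes "finite (carrier G)"
  shows "residual (p_supersolvable p) G = chief_residual G (p_chief_indices p)"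
proof (rule residual_eq_chief_residual)
  fix N assume N: "N \<lhd> G"
  interpret Q: group "G Mod N" by (rule normal.factorgroup_is_group[OF N])
  show "p_supersolvable p (G Mod N) \<longleftrightarrow> chief_indices_in G N (p_chief_indices p)"
    using Q.p_supersolvable_iff_chief_indices[OF finite_FactGroup[OF assms]]
      chief_indices_in_quotient_iff[OF assms N] by (simp only:)
qed

lemma chief_indices_in_mono:
  assumes "chief_indices_in G N S" "N \<subseteq> N'" "S \<subseteq> S'" shows "chief_indices_in G N' S'"
  using assms unfolding chief_indices_in_def by blast

lemma (in group) chief_residual_antimono:
  assumes "finite (carrier G)" "S \<subseteq> S'" shows "chief_residual G S' \<subseteq> chief_residual G S"
  by (rule chief_residual_least[OF chief_residual_normal(1)[OF assms(1)]])
    (rule chief_indices_in_mono[OF chief_residual_normal(2)[OF assms(1)] subset_refl assms(2)])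

lemma primes_subset_p_chief_indices:
  "prime p \<Longrightarrow> {n. prime n} \<subseteq> p_chief_indices p"
  using primes_dvd_imp_eq by (auto simp: p_chief_indices_def)

text \<open>Write \<open>R\<^sub>p\<close> for the residual of \<open>\<UU>\<^sub>p\<close> and let \<open>N / R\<^sub>p\<close> be the largest normal \<open>p'\<close>-subgroup of
  the quotient by \<open>R\<^sub>p\<close>. Then \<open>G Mod N\<close> is \<open>p\<close>-supersolvable without nontrivial normal
  \<open>p'\<close>-subgroups, hence supersolvable. So \<open>N\<close> contains the residual of \<open>\<UU>\<close>, whose index over \<open>R\<^sub>p\<close>
  divides that of \<open>N\<close>.\<close>
lemma (in group) index_residual_coprime:
  assumes fin: "finite (carrier G)" and s: "solvable G" and p: "prime p"
  shows "\<not> p dvd card (chief_residual G {n. prime n}) div card (chief_residual G (p_chief_indices p))"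
proof -
  let ?R = "chief_residual G {n. prime n}"
  let ?Rp = "chief_residual G (p_chief_indices p)"
  note Rp = chief_residual_normal[OF fin, of "p_chief_indices p"]
  note sRp = normal_imp_subgroup[OF Rp(1)]
  have posRp: "0 < card ?Rp" by (rule subgroup_card_pos[OF fin sRp])
  let ?P = "\<lambda>N. N \<lhd> G \<and> ?Rp \<subseteq> N \<and> \<not> p dvd card N div card ?Rp"
  have P1: "?P ?Rp" using Rp(1) posRp prime_gt_1_nat[OF p] by simp
  have "\<forall>N. ?P N \<longrightarrow> card N < Suc (card (carrier G))"
    using card_mono[OF fin subgroup.subset[OF normal_imp_subgroup]] by (simp add: less_Suc_eq_le)
  from ex_has_greatest_nat[of ?P, OF P1 this]
  obtain N where N: "?P N" and max: "\<And>N'. ?P N' \<Longrightarrow> card N' \<le> card N" by iprover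
  then have Nn: "N \<lhd> G" and RN: "?Rp \<subseteq> N" and pN: "\<not> p dvd card N div card ?Rp" by simp_all
  note sN = normal_imp_subgroup[OF Nn]
  have dvN: "card ?Rp dvd card N" by (rule subgroup_card_dvd[OF sRp sN RN])
  interpret Q: group "G Mod N" by (rule normal.factorgroup_is_group[OF Nn])
  have "chief_indices_in (G Mod N) {\<one>\<^bsub>G Mod N\<^esub>} {n. prime n}"
  proof (rule Q.p_supersolvable_core_free_imp_prime_indices[OF finite_FactGroup[OF fin]
        solvable_FactGroup[OF Nn s] p])
    show "chief_indices_in (G Mod N) {\<one>\<^bsub>G Mod N\<^esub>} (p_chief_indices p)"
      unfolding chief_indices_in_quotient_iff[OF fin Nn]
      by (rule chief_indices_in_mono[OF Rp(2) RN subset_refl])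
  next
    fix V assume V: "V \<lhd> G Mod N" and pV: "\<not> p dvd card V"
    note sV = normal_imp_subgroup[OF V]
    note im = Union_of_cosets[OF Nn sV]
    have M: "\<Union>V \<lhd> G" by (rule normal.factgroup_subgroup_union_normal[OF Nn V])
    have "card V * card N = card (\<Union>V)"
      using card_coset_image[OF sN normal_imp_subgroup[OF M] im(1)] unfolding im(2) .
    then have "card (\<Union>V) div card ?Rp = card V * (card N div card ?Rp)"
      using dvN by (metis div_mult_swap)
    then have "\<not> p dvd card (\<Union>V) div card ?Rp" using pV pN p by (simp add: prime_dvd_mult_iff)
    then have "?P (\<Union>V)" using M RN im(1) by blast
    then have "card (\<Union>V) \<le> card N" by (rule max)
    then have "N = \<Union>V" using card_seteq[OF normal_finite[OF fin M] im(1)] by blast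
    then show "V = {\<one>\<^bsub>G Mod N\<^esub>}" using im(2) coset_image_self[OF sN] by simp
  qed
  then have "chief_indices_in G N {n. prime n}" unfolding chief_indices_in_quotient_iff[OF fin Nn] .
  then have RsubN: "?R \<subseteq> N" by (rule chief_residual_least[OF Nn])
  have sR: "subgroup ?R G" by (rule normal_imp_subgroup[OF chief_residual_normal(1)[OF fin]])
  have RpR: "?Rp \<subseteq> ?R" by (rule chief_residual_antimono[OF fin primes_subset_p_chief_indices[OF p]])
  have "card ?R div card ?Rp dvd card N div card ?Rp"
    by (rule iffD2[OF div_dvd_div[OF subgroup_card_dvd[OF sRp sR RpR] dvN]
          subgroup_card_dvd[OF sR sN RsubN]])
  then show ?thesis using pN dvd_trans by blast
qed

definition p_elements :: "('a, 'b) monoid_scheme \<Rightarrow> nat \<Rightarrow> 'a set \<Rightarrow> 'a set"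
  where "p_elements G p R = {y \<in> R. \<exists>k::nat. y [^]\<^bsub>G\<^esub> (p ^ k) = \<one>\<^bsub>G\<^esub>}"

text \<open>The \<open>p\<close>-elements of \<open>R\<close> lie in \<open>R\<^sub>p\<close> because the index is prime to \<open>p\<close>. Conversely, the subgroup
  \<open>N\<close> that they generate is normal in \<open>G\<close> and contains a Sylow \<open>p\<close>-subgroup of \<open>R\<close>, so chief factors
  between \<open>N\<close> and \<open>R\<close> have order prime to \<open>p\<close>, while those above \<open>R\<close> have prime order. Hence
  \<open>G Mod N\<close> is \<open>p\<close>-supersolvable.\<close>
lemma (in group) p_residual_eq_generate:
  assumes fin: "finite (carrier G)" and s: "solvable G" and p: "prime p"
  shows "chief_residual G (p_chief_indices p) = generate G (p_elements G p (chief_residual G {n. prime n}))"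
    (is "?Rp = generate G ?E")
proof
  let ?R = "chief_residual G {n. prime n}"
  note Rp = chief_residual_normal[OF fin, of "p_chief_indices p"]
  note sRp = normal_imp_subgroup[OF Rp(1)]
  note R = chief_residual_normal[OF fin, of "{n. prime n}"]
  note sR = normal_imp_subgroup[OF R(1)]
  have RpR: "?Rp \<subseteq> ?R" by (rule chief_residual_antimono[OF fin primes_subset_p_chief_indices[OF p]])
  have ER: "?E \<subseteq> ?R" by (auto simp: p_elements_def)
  have Ec: "?E \<subseteq> carrier G" using ER subgroup.subset[OF sR] by blast
  interpret h: group_hom G "G Mod ?Rp" "(#>) ?Rp" by (rule quotient_hom[OF Rp(1)])
  have "?E \<subseteq> ?Rp"
  proof
    fix y assume "y \<in> ?E"
    then obtain k where y: "y \<in> ?R" "y [^] (p ^ k) = \<one>" by (auto simp: p_elements_def)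
    have yc: "y \<in> carrier G" by (rule subgroup.mem_carrier[OF sR y(1)])
    have "(?Rp #> y) [^]\<^bsub>G Mod ?Rp\<^esub> card ((#>) ?Rp ` ?R) = \<one>\<^bsub>G Mod ?Rp\<^esub>"
      by (rule h.H.pow_card_eq_one[OF coset_image_subgroup[OF Rp(1) sR] imageI[OF y(1)]])
    then have 1: "(?Rp #> y) [^]\<^bsub>G Mod ?Rp\<^esub> (card ?R div card ?Rp) = \<one>\<^bsub>G Mod ?Rp\<^esub>"
      using card_coset_image_eq_index[OF fin sR sRp RpR] by simp
    have 2: "(?Rp #> y) [^]\<^bsub>G Mod ?Rp\<^esub> (p ^ k) = \<one>\<^bsub>G Mod ?Rp\<^esub>"
      using h.hom_nat_pow[OF yc, of "p ^ k"] h.hom_one unfolding y(2) by simp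
    have "coprime (card ?R div card ?Rp) (p ^ k)"
      using index_residual_coprime[OF assms] p
      by (metis coprime_commute coprime_power_right_iff prime_imp_coprime)
    from h.H.eq_one_of_coprime_exponents[OF h.hom_closed[OF yc] 1 2 this]
    show "y \<in> ?Rp" using quotient_eq_one_iff[OF Rp(1) yc] by simp
  qed
  then show "generate G ?E \<subseteq> ?Rp" by (rule generate_subgroup_incl[OF _ sRp])
  let ?N = "generate G ?E"
  have N: "?N \<lhd> G"
  proof (rule normal_generateI[OF Ec])
    fix y x assume "y \<in> ?E" and x: "x \<in> carrier G"
    then obtain k where y: "y \<in> ?R" "y [^] (p ^ k) = \<one>" by (auto simp: p_elements_def)
    interpret cj: group_hom G G "\<lambda>g. x \<otimes> g \<otimes> inv x" by (rule conjugation_hom[OF x])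
    have "(x \<otimes> y \<otimes> inv x) [^] (p ^ k) = x \<otimes> y [^] (p ^ k) \<otimes> inv x"
      by (rule cj.hom_nat_pow[OF subgroup.mem_carrier[OF sR y(1)], symmetric])
    also have "\<dots> = \<one>" unfolding y(2) using x by simp
    finally show "x \<otimes> y \<otimes> inv x \<in> ?E"
      unfolding p_elements_def using normal.inv_op_closed2[OF R(1) x y(1)] by blast
  qed
  note sN = normal_imp_subgroup[OF N]
  have NR: "?N \<subseteq> ?R" by (rule generate_subgroup_incl[OF ER sR])
  have posR: "card ?R \<noteq> 0" using subgroup_card_pos[OF fin sR] by simp
  obtain m where m: "card ?R = p ^ multiplicity p (card ?R) * m" "\<not> p dvd m"
    using multiplicity_decompose'[OF posR, of p] p by (metis not_prime_unit)
  obtain P where P: "subgroup P G" "P \<subseteq> ?R" "card P = p ^ multiplicity p (card ?R)"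
    using sylow_in_subgroup[OF fin sR p m(1)] .
  have "P \<subseteq> ?E"
  proof
    fix y assume y: "y \<in> P"
    have "y [^] (p ^ multiplicity p (card ?R)) = \<one>" using pow_card_eq_one[OF P(1) y] P(3) by simp
    then show "y \<in> ?E" unfolding p_elements_def using y P(2) by blast
  qed
  then have "P \<subseteq> ?N" using generate.incl by (metis subset_iff)
  from subgroup_card_dvd[OF P(1) sN this]
  have PN: "p ^ multiplicity p (card ?R) dvd card ?N" using P(3) by simp
  have "chief_indices_in G ?N (p_chief_indices p)"
  proof (rule chief_indices_in_extend[OF fin R(1)])
    show "chief_indices_in G ?R (p_chief_indices p)"
      by (rule chief_indices_in_mono[OF R(2) subset_refl primes_subset_p_chief_indices[OF p]])
  next
    fix K L assume c: "chief_factor G K L" and KR: "K \<subseteq> ?R" and NL: "?N \<inter> ?R \<subseteq> L"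
    note cD = chief_factorD[OF c]
    have LK: "L \<subseteq> K" using cD(3) by blast
    have "?N \<subseteq> L" using NL NR by blast
    from dvd_trans[OF PN subgroup_card_dvd[OF sN cD(5) this]]
    have PL: "p ^ multiplicity p (card ?R) dvd card L" .
    have "(card K div card L) * card L = card K"
      by (rule dvd_div_mult_self[OF subgroup_card_dvd[OF cD(5,4) LK]])
    moreover have "card K dvd card ?R" by (rule subgroup_card_dvd[OF cD(4) sR KR])
    ultimately have "p ^ multiplicity p (card ?R) * (card K div card L) dvd p ^ multiplicity p (card ?R) * m"
      using PL m(1) by (metis dvd_refl dvd_trans mult.commute mult_dvd_mono)
    then have "card K div card L dvd m" using p by simp
    then have "\<not> p dvd card K div card L" using m(2) dvd_trans by blast
    then show "card K div card L \<in> p_chief_indices p" by (simp add: p_chief_indices_def)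
  qed
  then show "?Rp \<subseteq> ?N" by (rule chief_residual_least[OF N])
qed

text \<open>The order of a chief factor above all the \<open>p\<close>-residuals is a power of some prime \<open>q\<close> in \<open>Ps\<close>;
  since the factor lies above the \<open>q\<close>-residual, this power is \<open>q\<close> itself.\<close>
lemma (in group) residual_eq_generate_p_residuals:
  assumes fin: "finite (carrier G)" and s: "solvable G"
    and primes: "\<And>p. p \<in> Ps \<Longrightarrow> prime p" and all: "\<And>p. prime p \<Longrightarrow> p dvd card (carrier G) \<Longrightarrow> p \<in> Ps"
  shows "chief_residual G {n. prime n} = generate G (\<Union>p\<in>Ps. chief_residual G (p_chief_indices p))"
    (is "?R = generate G ?U")
proof
  note R = chief_residual_normal[OF fin, of "{n. prime n}"]
  note sR = normal_imp_subgroup[OF R(1)]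
  have UR: "?U \<subseteq> ?R"
    using chief_residual_antimono[OF fin primes_subset_p_chief_indices[OF primes]] by blast
  then show "generate G ?U \<subseteq> ?R" by (rule generate_subgroup_incl[OF _ sR])
  let ?N = "generate G ?U"
  have N: "?N \<lhd> G"
  proof (rule normal_generateI)
    show "?U \<subseteq> carrier G" using UR subgroup.subset[OF sR] by blast
    fix y x assume "y \<in> ?U" and x: "x \<in> carrier G"
    then obtain p where p: "p \<in> Ps" "y \<in> chief_residual G (p_chief_indices p)" by blast
    show "x \<otimes> y \<otimes> inv x \<in> ?U"
      using normal.inv_op_closed2[OF chief_residual_normal(1)[OF fin] x p(2)] p(1) by blast
  qed
  have "chief_indices_in G ?N {n. prime n}" unfolding chief_indices_in_def
  proof (intro allI impI, elim conjE, rule CollectI)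
    fix K L assume c: "chief_factor G K L" and NL: "?N \<subseteq> L"
    note cD = chief_factorD[OF c]
    have LK: "L \<subseteq> K" using cD(3) by blast
    obtain q k where q: "prime q" "0 < k" "card K div card L = q ^ k"
      using solvable_chief_index_prime_power[OF fin s c] by blast
    have qdvd: "q dvd card K div card L" unfolding q(3) using q(2) by simp
    also have "card K div card L dvd card K"
      using dvd_div_mult_self[OF subgroup_card_dvd[OF cD(5,4) LK]] by (metis dvd_triv_left)
    also have "card K dvd card (carrier G)"
      by (rule subgroup_card_dvd[OF cD(4) subgroup_self subgroup.subset[OF cD(4)]])
    finally have "q \<in> Ps" using all q(1) by blast
    then have "chief_residual G (p_chief_indices q) \<subseteq> ?U" by blast
    then have "chief_residual G (p_chief_indices q) \<subseteq> L" using NL generate.incl by (metis subset_iff)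
    from chief_indices_inD[OF chief_residual_normal(2)[OF fin] c this]
    have "card K div card L = q" using qdvd by (simp add: p_chief_indices_def)
    then show "prime (card K div card L)" using q(1) by simp
  qed
  then show "?R \<subseteq> ?N" by (rule chief_residual_least[OF N])
qed

section \<open>Normalizers\<close>

lemma (in group) mem_normalizer_iff:
  assumes "A \<subseteq> carrier G"
  shows "x \<in> normalizer G A \<longleftrightarrow> x \<in> carrier G \<and> (\<lambda>g. x \<otimes> g \<otimes> inv x) ` A = A"
proof -
  have "x <# A #> inv x = (\<lambda>g. x \<otimes> g \<otimes> inv x) ` A"
    by (auto simp: l_coset_def r_coset_def)
  then show ?thesis using assms by (simp add: normalizer_def stabilizer_def)
qed

lemma (in group) normalizer_generate:
  assumes "A \<subseteq> carrier G" "x \<in> normalizer G A" shows "x \<in> normalizer G (generate G A)"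
proof -
  have x: "x \<in> carrier G" "(\<lambda>g. x \<otimes> g \<otimes> inv x) ` A = A"
    using assms mem_normalizer_iff[OF assms(1)] by auto
  interpret cj: group_hom G G "\<lambda>g. x \<otimes> g \<otimes> inv x" by (rule conjugation_hom[OF x(1)])
  have "generate G A \<subseteq> carrier G" by (rule generate_incl[OF assms(1)])
  then show ?thesis
    using mem_normalizer_iff cj.generate_img[OF assms(1)] x by simp
qed

lemma (in group) normalizer_p_elements:
  assumes "R \<subseteq> carrier G" "x \<in> normalizer G R" shows "x \<in> normalizer G (p_elements G p R)"
proof -
  have x: "x \<in> carrier G" "(\<lambda>g. x \<otimes> g \<otimes> inv x) ` R = R"
    using assms mem_normalizer_iff[OF assms(1)] by auto
  interpret cj: group_hom G G "\<lambda>g. x \<otimes> g \<otimes> inv x" by (rule conjugation_hom[OF x(1)])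
  have one: "x \<otimes> g \<otimes> inv x = \<one> \<longleftrightarrow> g = \<one>" if g: "g \<in> carrier G" for g
  proof
    assume "x \<otimes> g \<otimes> inv x = \<one>"
    then have "x \<otimes> g = \<one> \<otimes> x" by (rule iffD1[OF inv_solve_right', rotated -1]) (use x g in simp_all)
    then show "g = \<one>" using x(1) g by simp
  qed (use x in simp)
  have pow: "(\<exists>k::nat. (x \<otimes> g \<otimes> inv x) [^] (p ^ k) = \<one>) \<longleftrightarrow> (\<exists>k::nat. g [^] (p ^ k) = \<one>)"
    if g: "g \<in> carrier G" for g
    using cj.hom_nat_pow[OF g] one[OF nat_pow_closed[OF g]] by metis
  have "(\<lambda>g. x \<otimes> g \<otimes> inv x) ` p_elements G p R = {y \<in> (\<lambda>g. x \<otimes> g \<otimes> inv x) ` R. \<exists>k::nat. y [^] (p ^ k) = \<one>}"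
    unfolding p_elements_def using pow assms(1) by auto
  also have "\<dots> = p_elements G p R" unfolding x(2) p_elements_def ..
  finally show ?thesis using mem_normalizer_iff[of "p_elements G p R"] x(1) assms(1)
    by (auto simp: p_elements_def)
qed

lemma (in group) normalizer_Union:
  assumes "\<And>i. i \<in> I \<Longrightarrow> A i \<subseteq> carrier G" "\<And>i. i \<in> I \<Longrightarrow> x \<in> normalizer G (A i)" "x \<in> carrier G"
  shows "x \<in> normalizer G (\<Union>i\<in>I. A i)"
proof -
  have "(\<Union>i\<in>I. A i) \<subseteq> carrier G" using assms(1) by blast
  moreover have "(\<lambda>g. x \<otimes> g \<otimes> inv x) ` (\<Union>i\<in>I. A i) = (\<Union>i\<in>I. A i)"
    unfolding image_UN using assms(1,2) mem_normalizer_iff by simp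
  ultimately show ?thesis using mem_normalizer_iff assms(3) by simp
qed

lemma (in group) solvable_restrict:
  assumes "solvable G" "subgroup T G" shows "solvable (G\<lparr>carrier := T\<rparr>)"
proof -
  interpret T: group "G\<lparr>carrier := T\<rparr>" by (rule subgroup_imp_group[OF assms(2)])
  have "group_hom (G\<lparr>carrier := T\<rparr>) G id"
    using subgroup.subset[OF assms(2)] T.is_group is_group
    by (auto simp: group_hom_def group_hom_axioms_def hom_def)
  then show ?thesis by (rule group_hom.inj_hom_imp_solvable) (use assms(1) in simp_all)
qed

text \<open>Each residual is generated by a set that is defined from the other residual or residuals and is
  carried along by every conjugation that preserves them.\<close>
theorem (in group) normalizer_residual_iff:
  assumes fin: "finite (carrier G)" and s: "solvable G" and T: "subgroup T G" and x: "x \<in> carrier G"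
    and primes: "\<And>p. p \<in> Ps \<Longrightarrow> prime p" and all: "\<And>p. prime p \<Longrightarrow> p dvd card T \<Longrightarrow> p \<in> Ps"
  shows "x \<in> normalizer G (residual supersolvable (G\<lparr>carrier := T\<rparr>)) \<longleftrightarrow>
    (\<forall>p\<in>Ps. x \<in> normalizer G (residual (p_supersolvable p) (G\<lparr>carrier := T\<rparr>)))"
proof -
  let ?T = "G\<lparr>carrier := T\<rparr>"
  interpret T: group ?T by (rule subgroup_imp_group[OF T])
  have finT: "finite (carrier ?T)" using fin subgroup.subset[OF T] finite_subset by auto
  have sT: "solvable ?T" by (rule solvable_restrict[OF s T])
  let ?R = "residual supersolvable ?T"
  let ?Rp = "\<lambda>p. residual (p_supersolvable p) ?T"
  have RT: "?R \<subseteq> T" and RpT: "?Rp p \<subseteq> T" for p by (auto simp: residual_def)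
  then have Rc: "?R \<subseteq> carrier G" and Rpc: "?Rp p \<subseteq> carrier G" for p
    using subgroup.subset[OF T] by blast+
  have gen1: "?R = generate G (\<Union>p\<in>Ps. ?Rp p)"
  proof -
    have "?R = generate ?T (\<Union>p\<in>Ps. ?Rp p)"
      unfolding T.residual_supersolvable[OF finT] T.residual_p_supersolvable[OF finT]
      by (rule T.residual_eq_generate_p_residuals[OF finT sT primes]) (use all in auto)
    also have "\<dots> = generate G (\<Union>p\<in>Ps. ?Rp p)"
      by (rule generate_consistent[OF _ T]) (use RpT in blast)
    finally show ?thesis .
  qed
  have gen2: "?Rp p = generate G (p_elements G p ?R)" if "p \<in> Ps" for p
  proof -
    have "?Rp p = generate ?T (p_elements ?T p ?R)"
      unfolding T.residual_supersolvable[OF finT] T.residual_p_supersolvable[OF finT]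
      by (rule T.p_residual_eq_generate[OF finT sT primes[OF that]])
    also have "p_elements ?T p ?R = p_elements G p ?R"
      unfolding p_elements_def by (simp add: nat_pow_consistent[symmetric])
    also have "generate ?T (p_elements G p ?R) = generate G (p_elements G p ?R)"
      by (rule generate_consistent[OF _ T]) (use RT in \<open>auto simp: p_elements_def\<close>)
    finally show ?thesis .
  qed
  show ?thesis
  proof
    assume a: "x \<in> normalizer G ?R"
    show "\<forall>p\<in>Ps. x \<in> normalizer G (?Rp p)"
    proof
      fix p assume p: "p \<in> Ps"
      have "p_elements G p ?R \<subseteq> carrier G" using Rc by (auto simp: p_elements_def)
      from normalizer_generate[OF this normalizer_p_elements[OF Rc a]]
      show "x \<in> normalizer G (?Rp p)" unfolding gen2[OF p] .
    qed
  next
    assume "\<forall>p\<in>Ps. x \<in> normalizer G (?Rp p)"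
    then have "x \<in> normalizer G (\<Union>p\<in>Ps. ?Rp p)" using normalizer_Union[of Ps ?Rp] Rpc x by blast
    then show "x \<in> normalizer G ?R"
      unfolding gen1 by (rule normalizer_generate[rotated]) (use Rpc in blast)
  qed
qed

text \<open>For \<open>H = {\<one>}\<close> there are no primes to consider, and both subgroups are \<open>carrier G\<close>; the
  membership of \<open>x\<close> in \<open>carrier G\<close> on the right-hand side comes from the subgroup \<open>T = {\<one>}\<close>.\<close>
theorem theorem3p14:
  fixes G :: "('a, 'b) monoid_scheme" (structure) and H :: "'a set"
  assumes "group G" and "finite (carrier G)" and "solvable G" and "H \<lhd> G"
  shows "carrier G \<inter> (\<Inter>p \<in> prime_factors (card H). residual_normalizer (p_supersolvable p) G H) = {\<one>}
    \<longleftrightarrow> residual_normalizer supersolvable G H = {\<one>}"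
proof -
  interpret group G by fact
  let ?Ps = "prime_factors (card H)"
  note sH = normal_imp_subgroup[OF assms(4)]
  have posH: "card H \<noteq> 0" using subgroup_card_pos[OF assms(2) sH] by simp
  have iff: "x \<in> normalizer G (residual supersolvable (G\<lparr>carrier := T\<rparr>)) \<longleftrightarrow>
      (\<forall>p\<in>?Ps. x \<in> normalizer G (residual (p_supersolvable p) (G\<lparr>carrier := T\<rparr>)))"
    if T: "subgroup T (G\<lparr>carrier := H\<rparr>)" and x: "x \<in> carrier G" for T x
  proof (rule normalizer_residual_iff[OF assms(2,3) _ x])
    show sT: "subgroup T G" by (rule incl_subgroup[OF sH T])
    have "T \<subseteq> H" using subgroup.subset[OF T] by simp
    then have TH: "card T dvd card H" by (rule subgroup_card_dvd[OF sT sH])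
    fix p :: nat
    show "p \<in> ?Ps \<Longrightarrow> prime p" by (rule in_prime_factors_imp_prime)
    show "p \<in> ?Ps" if "prime p" "p dvd card T"
      using that posH dvd_trans[OF that(2) TH] by (simp add: prime_factors_dvd)
  qed
  have "{\<one>} \<subseteq> H" using subgroup.one_closed[OF sH] by simp
  then have triv: "subgroup {\<one>} (G\<lparr>carrier := H\<rparr>)" by (rule subgroup_incl[OF triv_subgroup sH])
  have "normalizer G A \<subseteq> carrier G" for A by (auto simp: normalizer_def stabilizer_def)
  then have sub: "residual_normalizer supersolvable G H \<subseteq> carrier G"
    unfolding residual_normalizer_def using triv by blast
  have "carrier G \<inter> (\<Inter>p \<in> ?Ps. residual_normalizer (p_supersolvable p) G H)
      = residual_normalizer supersolvable G H"
  proof (intro equalityI subsetI)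
    fix x assume "x \<in> carrier G \<inter> (\<Inter>p \<in> ?Ps. residual_normalizer (p_supersolvable p) G H)"
    then show "x \<in> residual_normalizer supersolvable G H"
      unfolding residual_normalizer_def using iff by simp
  next
    fix x assume x: "x \<in> residual_normalizer supersolvable G H"
    then have "x \<in> carrier G" using sub by blast
    then show "x \<in> carrier G \<inter> (\<Inter>p \<in> ?Ps. residual_normalizer (p_supersolvable p) G H)"
      using x unfolding residual_normalizer_def using iff by simp
  qed
  then show ?thesis by simp
qed

end
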